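(* Let $n\ge 1$, let $\mathfrak{M}=(M,\mathcal{M})$ be a countable model of $\mathbf{RCA_0}+I\Sigma_n$, and let $W\subseteq|M|$ be an arbitrary subset. Then $\mathfrak{M}$ is an $\omega$-submodel of some $\mathfrak{M}'=(M,\mathcal{M}')$ such that $\mathfrak{M}'\vDash\mathbf{RCA_0}+I\Sigma_n$ and there is some $S\in\mathcal{M}'$ which is $n$-convergent and satisfies $\lim^nS=W$.
   Context: Models of second-order arithmetic have the form $\mathfrak{M}=(M,\mathcal{M})$, where $M$ is a first-order structure for arithmetic with universe $|M|$ and $\mathcal{M}\subseteq\mathcal{P}(|M|)$. $\mathfrak{M}$ is countable if both $|M|$ and $\mathcal{M}$ have cardinality $\aleph_0$. $\mathfrak{M}=(M,\mathcal{M})$ is an $\omega$-submodel of $\mathfrak{M}'=(M',\mathcal{M}')$ if $M=M'$ and $\mathcal{M}\subseteq\mathcal{M}'$. $\mathbf{RCA_0}$ is the usual base theory of reverse mathematics; $I\Sigma_n$ is induction for $\Sigma_n$ formulas with number and set parameters. Fix an internal (definable in $M$) bijective pairing function $(\cdot,\cdot):|M|^2\to|M|$. A set $X\subseteq|M|$ is convergent if for each $i\in|M|$ there is an $m\in|M|$ such that for all $m'\ge m$, $(i,m')\in X$ iff $(i,m)\in X$; in that case $\lim X=\{i\in|M| : \exists m\in |M|\ \forall m'\ge m\ (i,m')\in X\}$. Every $S$ is $0$-convergent, with $\lim^0S=S$; if $S$ is $k$-convergent, then $S$ is $(k+1)$-convergent if $\lim^kS$ is convergent, and then $\lim^{k+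1}S=\lim(\lim^kS)$.
   Formalization: The fixed internal bijective pairing function is required to have a Σ₁-definable graph in M (number parameters allowed; Cantor pairing qualifies), since for arbitrary definable pairings the claim can fail in models where induction fails for complex formulas. *)

theory Defs
  imports Main "HOL-Library.Countable_Set"
begin

section \<open>The language of second-order arithmetic\<close>

text \<open>Number variables and set variables are two separate sorts, both named by naturals.\<close>

datatype tm = Var nat | Zero | One | Add tm tm | Mul tm tm

datatype fm =
    Eq tm tm
  | Less tm tm
  | Mem tm nat
  | Neg fm
  | Conj fm fm
  | Disj fm fm
  | All nat fm
  | Ex nat fm
  | SAll nat fm
  | SEx nat fm

primrec tm_vars :: "tm \<Rightarrow> nat set" where
  "tm_vars (Var x) = {x}"
| "tm_vars Zero = {}"
| "tm_vars One = {}"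
| "tm_vars (Add t u) = tm_vars t \<union> tm_vars u"
| "tm_vars (Mul t u) = tm_vars t \<union> tm_vars u"

text \<open>Formulas of the first-order language of arithmetic: no set variable occurs.\<close>

primrec first_order :: "fm \<Rightarrow> bool" where
  "first_order (Eq t u) = True"
| "first_order (Less t u) = True"
| "first_order (Mem t X) = False"
| "first_order (Neg \<phi>) = first_order \<phi>"
| "first_order (Conj \<phi> \<psi>) = (first_order \<phi> \<and> first_order \<psi>)"
| "first_order (Disj \<phi> \<psi>) = (first_order \<phi> \<and> first_order \<psi>)"
| "first_order (All x \<phi>) = first_order \<phi>"
| "first_order (Ex x \<phi>) = first_order \<phi>"
| "first_order (SAll X \<phi>) = False"
| "first_order (SEx X \<phi>) = False"

abbreviation BAll :: "nat \<Rightarrow> tm \<Rightarrow> fm \<Rightarrow> fm" where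
  "BAll x t \<phi> \<equiv> All x (Disj (Neg (Less (Var x) t)) \<phi>)"

abbreviation BEx :: "nat \<Rightarrow> tm \<Rightarrow> fm \<Rightarrow> fm" where
  "BEx x t \<phi> \<equiv> Ex x (Conj (Less (Var x) t) \<phi>)"

inductive Delta0 :: "fm \<Rightarrow> bool" where
  "Delta0 (Eq t u)"
| "Delta0 (Less t u)"
| "Delta0 (Mem t X)"
| "Delta0 \<phi> \<Longrightarrow> Delta0 (Neg \<phi>)"
| "Delta0 \<phi> \<Longrightarrow> Delta0 \<psi> \<Longrightarrow> Delta0 (Conj \<phi> \<psi>)"
| "Delta0 \<phi> \<Longrightarrow> Delta0 \<psi> \<Longrightarrow> Delta0 (Disj \<phi> \<psi>)"
| "Delta0 \<phi> \<Longrightarrow> x \<notin> tm_vars t \<Longrightarrow> Delta0 (BAll x t \<phi>)"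
| "Delta0 \<phi> \<Longrightarrow> x \<notin> tm_vars t \<Longrightarrow> Delta0 (BEx x t \<phi>)"

text \<open>
  Arithmetical hierarchy in prenex form: \<open>is_Sigma n\<close> consists of \<open>n\<close> alternating, possibly empty
  blocks of number quantifiers, the outermost block being existential, in front of a bounded
  formula.  Free set variables (set parameters) are allowed, set quantifiers are not.
\<close>

inductive is_Sigma :: "nat \<Rightarrow> fm \<Rightarrow> bool" and is_Pi :: "nat \<Rightarrow> fm \<Rightarrow> bool" where
  "Delta0 \<phi> \<Longrightarrow> is_Sigma 0 \<phi>"
| "is_Pi n \<phi> \<Longrightarrow> is_Sigma (Suc n) \<phi>"
| "is_Sigma (Suc n) \<phi> \<Longrightarrow> is_Sigma (Suc n) (Ex x \<phi>)"
| "Delta0 \<phi> \<Longrightarrow> is_Pi 0 \<phi>"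
| "is_Sigma n \<phi> \<Longrightarrow> is_Pi (Suc n) \<phi>"
| "is_Pi (Suc n) \<phi> \<Longrightarrow> is_Pi (Suc n) (All x \<phi>)"


section \<open>Models\<close>

text \<open>
  The universe of a first-order structure is the whole type \<open>'a\<close>.
\<close>

record 'a arith =
  zero :: 'a
  one :: 'a
  add :: "'a \<Rightarrow> 'a \<Rightarrow> 'a"
  mul :: "'a \<Rightarrow> 'a \<Rightarrow> 'a"
  less :: "'a \<Rightarrow> 'a \<Rightarrow> bool"

definition leq :: "'a arith \<Rightarrow> 'a \<Rightarrow> 'a \<Rightarrow> bool" where
  "leq M a b \<longleftrightarrow> less M a b \<or> a = b"

record 'a so_model =
  numbers :: "'a arith"
  sets :: "'a set set"

definition countable_model :: "'a so_model \<Rightarrow> bool" where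
  "countable_model \<MM> \<longleftrightarrow>
     countable (UNIV :: 'a set) \<and> infinite (UNIV :: 'a set) \<and>
     countable (sets \<MM>) \<and> infinite (sets \<MM>)"

definition omega_submodel :: "'a so_model \<Rightarrow> 'a so_model \<Rightarrow> bool" where
  "omega_submodel \<MM> \<MM>' \<longleftrightarrow> numbers \<MM> = numbers \<MM>' \<and> sets \<MM> \<subseteq> sets \<MM>'"

primrec tm_val :: "'a arith \<Rightarrow> (nat \<Rightarrow> 'a) \<Rightarrow> tm \<Rightarrow> 'a" where
  "tm_val M e (Var x) = e x"
| "tm_val M e Zero = zero M"
| "tm_val M e One = one M"
| "tm_val M e (Add t u) = add M (tm_val M e t) (tm_val M e u)"
| "tm_val M e (Mul t u) = mul M (tm_val M e t) (tm_val M e u)"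

text \<open>\<open>e\<close> assigns numbers to the number variables, \<open>s\<close> assigns sets to the set variables.\<close>

primrec sat :: "'a so_model \<Rightarrow> (nat \<Rightarrow> 'a) \<Rightarrow> (nat \<Rightarrow> 'a set) \<Rightarrow> fm \<Rightarrow> bool" where
  "sat \<MM> e s (Eq t u) \<longleftrightarrow> tm_val (numbers \<MM>) e t = tm_val (numbers \<MM>) e u"
| "sat \<MM> e s (Less t u) \<longleftrightarrow> less (numbers \<MM>) (tm_val (numbers \<MM>) e t) (tm_val (numbers \<MM>) e u)"
| "sat \<MM> e s (Mem t X) \<longleftrightarrow> tm_val (numbers \<MM>) e t \<in> s X"
| "sat \<MM> e s (Neg \<phi>) \<longleftrightarrow> \<not> sat \<MM> e s \<phi>"
| "sat \<MM> e s (Conj \<phi> \<psi>) \<longleftrightarrow> sat \<MM> e s \<phi> \<and> sat \<MM> e s \<psi>"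
| "sat \<MM> e s (Disj \<phi> \<psi>) \<longleftrightarrow> sat \<MM> e s \<phi> \<or> sat \<MM> e s \<psi>"
| "sat \<MM> e s (All x \<phi>) \<longleftrightarrow> (\<forall>a. sat \<MM> (e(x := a)) s \<phi>)"
| "sat \<MM> e s (Ex x \<phi>) \<longleftrightarrow> (\<exists>a. sat \<MM> (e(x := a)) s \<phi>)"
| "sat \<MM> e s (SAll X \<phi>) \<longleftrightarrow> (\<forall>A\<in>sets \<MM>. sat \<MM> e (s(X := A)) \<phi>)"
| "sat \<MM> e s (SEx X \<phi>) \<longleftrightarrow> (\<exists>A\<in>sets \<MM>. sat \<MM> e (s(X := A)) \<phi>)"


section \<open>The theories\<close>

definition basic_axioms :: "'a arith \<Rightarrow> bool" where
  "basic_axioms M \<longleftrightarrow>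
     (\<forall>a. add M a (one M) \<noteq> zero M) \<and>
     (\<forall>a b. add M a (one M) = add M b (one M) \<longrightarrow> a = b) \<and>
     (\<forall>a. add M a (zero M) = a) \<and>
     (\<forall>a b. add M a (add M b (one M)) = add M (add M a b) (one M)) \<and>
     (\<forall>a. mul M a (zero M) = zero M) \<and>
     (\<forall>a b. mul M a (add M b (one M)) = add M (mul M a b) a) \<and>
     (\<forall>a. \<not> less M a (zero M)) \<and>
     (\<forall>a b. less M a (add M b (one M)) \<longleftrightarrow> less M a b \<or> a = b)"

text \<open>
  The schemes below are stated as the truth of all universal closures of their instances: the
  variables of \<open>\<phi>\<close> other than \<open>x\<close> are parameters, interpreted by arbitrary numbers (\<open>e\<close>) and by
  arbitrary sets of the model (\<open>s\<close>).
\<close>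

definition models_induction :: "'a so_model \<Rightarrow> fm \<Rightarrow> bool" where
  "models_induction \<MM> \<phi> \<longleftrightarrow>
     (\<forall>x e s. range s \<subseteq> sets \<MM> \<longrightarrow>
        sat \<MM> (e(x := zero (numbers \<MM>))) s \<phi> \<longrightarrow>
        (\<forall>a. sat \<MM> (e(x := a)) s \<phi> \<longrightarrow>
             sat \<MM> (e(x := add (numbers \<MM>) a (one (numbers \<MM>)))) s \<phi>) \<longrightarrow>
        (\<forall>a. sat \<MM> (e(x := a)) s \<phi>))"

definition models_ISigma :: "nat \<Rightarrow> 'a so_model \<Rightarrow> bool" where
  "models_ISigma n \<MM> \<longleftrightarrow> (\<forall>\<phi>. is_Sigma n \<phi> \<longrightarrow> models_induction \<MM> \<phi>)"

definition models_Delta1_CA :: "'a so_model \<Rightarrow> bool" where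
  "models_Delta1_CA \<MM> \<longleftrightarrow>
     (\<forall>\<phi> \<psi> x e s. is_Sigma 1 \<phi> \<longrightarrow> is_Pi 1 \<psi> \<longrightarrow> range s \<subseteq> sets \<MM> \<longrightarrow>
        (\<forall>a. sat \<MM> (e(x := a)) s \<phi> \<longleftrightarrow> sat \<MM> (e(x := a)) s \<psi>) \<longrightarrow>
        {a. sat \<MM> (e(x := a)) s \<phi>} \<in> sets \<MM>)"

definition models_RCA0 :: "'a so_model \<Rightarrow> bool" where
  "models_RCA0 \<MM> \<longleftrightarrow>
     basic_axioms (numbers \<MM>) \<and> models_ISigma 1 \<MM> \<and> models_Delta1_CA \<MM>"


section \<open>Pairing and iterated limits\<close>

text \<open>
  An internal pairing function: a bijection whose graph is defined in the first-order structure
  by a \<open>is_Sigma 1\<close> formula (number parameters allowed), so that, being total, it is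
  \<open>\<Delta>\<^sub>1\<close>-definable, as the Cantor pairing function is.  Definability by formulas of
  arbitrary complexity would be too liberal: in a model where induction fails for complex formulas
  such a bijection can place a proper definable cut inside a bounded part of a column, and then a
  set converging along the columns may be forced to violate even bounded induction.
  The set assignment is irrelevant for a first-order formula.
\<close>

definition internal_pairing :: "'a so_model \<Rightarrow> ('a \<Rightarrow> 'a \<Rightarrow> 'a) \<Rightarrow> bool" where
  "internal_pairing \<MM> p \<longleftrightarrow>
     bij (\<lambda>(i, m). p i m) \<and>
     (\<exists>\<phi> e. first_order \<phi> \<and> is_Sigma 1 \<phi> \<and>
        (\<forall>i m z. z = p i m \<longleftrightarrow> sat \<MM> (e(0 := i, 1 := m, 2 := z)) (\<lambda>_. {}) \<phi>))"

definition convergent_set :: "'a arith \<Rightarrow> ('a \<Rightarrow> 'a \<Rightarrow> 'a) \<Rightarrow> 'a set \<Rightarrow> bool" where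
  "convergent_set M p X \<longleftrightarrow>
     (\<forall>i. \<exists>m. \<forall>m'. leq M m m' \<longrightarrow> (p i m' \<in> X \<longleftrightarrow> p i m \<in> X))"

definition lim_set :: "'a arith \<Rightarrow> ('a \<Rightarrow> 'a \<Rightarrow> 'a) \<Rightarrow> 'a set \<Rightarrow> 'a set" where
  "lim_set M p X = {i. \<exists>m. \<forall>m'. leq M m m' \<longrightarrow> p i m' \<in> X}"

text \<open>\<open>iter_lim M p k S\<close> is meaningful only if \<open>S\<close> is \<open>k\<close>-convergent.\<close>

primrec iter_lim :: "'a arith \<Rightarrow> ('a \<Rightarrow> 'a \<Rightarrow> 'a) \<Rightarrow> nat \<Rightarrow> 'a set \<Rightarrow> 'a set" where
  "iter_lim M p 0 S = S"
| "iter_lim M p (Suc k) S = lim_set M p (iter_lim M p k S)"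

primrec iter_convergent :: "'a arith \<Rightarrow> ('a \<Rightarrow> 'a \<Rightarrow> 'a) \<Rightarrow> nat \<Rightarrow> 'a set \<Rightarrow> bool" where
  "iter_convergent M p 0 S \<longleftrightarrow> True"
| "iter_convergent M p (Suc k) S \<longleftrightarrow>
     iter_convergent M p k S \<and> convergent_set M p (iter_lim M p k S)"

end

theory Submission
  imports Defs
begin

text \<open>
  The set \<open>S\<close> is obtained by forcing over the countable model.  A condition consists of \<open>n + 1\<close>
  coded finite partial functions \<open>\<sigma>\<^sub>0, \<dots>, \<sigma>\<^sub>n\<close>, where \<open>\<sigma>\<^sub>j\<close> approximates the \<open>j\<close>-fold limit of \<open>S\<close>
  and \<open>\<sigma>\<^sub>n\<close> is a part of the arbitrary set \<open>W\<close>.  New values of \<open>\<sigma>\<^sub>j\<close> have to agree with the columns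
  already decided by \<open>\<sigma>\<^sub>j\<^sub>+\<^sub>1\<close>, and so the limits of a generic \<open>S\<close> come out right.  Forcing a \<open>\<Sigma>\<^sub>k\<close>
  statement only involves \<open>\<sigma>\<^sub>0, \<dots>, \<sigma>\<^sub>k\<^sub>-\<^sub>1\<close>, and its negation also \<open>\<sigma>\<^sub>k\<close> as a fixed bound; hence for
  \<open>k \<le> n\<close> forcing is \<open>\<Sigma>\<^sub>k\<close>-definable in the ground model although \<open>W\<close> is not.  Given a \<open>\<Sigma>\<^sub>k\<close>
  statement \<open>\<theta>(x)\<close>, induction in the ground model for \<open>some extension forces \<theta>(x)\<close> provides an
  extension which forces \<open>\<not> \<theta>(0)\<close>, or \<open>\<theta>(b)\<close>, or \<open>\<theta>(x) \<and> \<not> \<theta>(x + 1)\<close> for some \<open>x\<close>.  The new model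
  consists of the sets that are \<open>\<Delta>\<^sub>1\<close> in \<open>S\<close> and a set of the ground model.
\<close>

section \<open>Arithmetic in the model\<close>

lemma Delta0_simps [simp]:
  "Delta0 (Eq t u)" "Delta0 (Less t u)" "Delta0 (Mem t X)"
  "Delta0 (Neg \<phi>) \<longleftrightarrow> Delta0 \<phi>"
  "Delta0 (Conj \<phi> \<psi>) \<longleftrightarrow> Delta0 \<phi> \<and> Delta0 \<psi>"
  "Delta0 (Disj \<phi> \<psi>) \<longleftrightarrow> Delta0 \<phi> \<and> Delta0 \<psi>"
  "Delta0 (BAll x t \<phi>) \<longleftrightarrow> Delta0 \<phi> \<and> x \<notin> tm_vars t"
  "Delta0 (BEx x t \<phi>) \<longleftrightarrow> Delta0 \<phi> \<and> x \<notin> tm_vars t"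
  by (auto intro: Delta0.intros elim: Delta0.cases)

lemma Delta0_is_Sigma1: "Delta0 \<phi> \<Longrightarrow> is_Sigma 1 \<phi>"
  and Delta0_is_Pi1: "Delta0 \<phi> \<Longrightarrow> is_Pi 1 \<phi>"
  using is_Sigma_is_Pi.intros(1,4)[of \<phi>] is_Sigma_is_Pi.intros(2,5)[of 0 \<phi>] by simp_all

lemma is_Sigma1_Ex: "is_Sigma 1 \<phi> \<Longrightarrow> is_Sigma 1 (Ex x \<phi>)"
  and is_Pi1_All: "is_Pi 1 \<phi> \<Longrightarrow> is_Pi 1 (All x \<phi>)"
  using is_Sigma_is_Pi.intros(3,6)[of 0] by simp_all

locale rca_model =
  fixes \<MM> :: "'a so_model"
  assumes basic: "basic_axioms (numbers \<MM>)"
    and ISigma1: "models_ISigma 1 \<MM>"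
    and Delta1_CA: "models_Delta1_CA \<MM>"
    and sets_nonempty: "sets \<MM> \<noteq> {}"
begin

abbreviation plusM (infixl "\<oplus>" 65) where "plusM \<equiv> add (numbers \<MM>)"
abbreviation timesM (infixl "\<otimes>" 70) where "timesM \<equiv> mul (numbers \<MM>)"
abbreviation zeroM ("\<zero>") where "zeroM \<equiv> zero (numbers \<MM>)"
abbreviation oneM ("\<one>") where "oneM \<equiv> one (numbers \<MM>)"
abbreviation lessM (infix "\<prec>" 50) where "lessM \<equiv> less (numbers \<MM>)"
abbreviation leM (infix "\<preceq>" 50) where "leM \<equiv> leq (numbers \<MM>)"

lemma plus_one_neq_zero: "a \<oplus> \<one> \<noteq> \<zero>"
  and plus_one_inject: "a \<oplus> \<one> = b \<oplus> \<one> \<Longrightarrow> a = b"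
  and plus_zero: "a \<oplus> \<zero> = a"
  and plus_plus_one: "a \<oplus> (b \<oplus> \<one>) = a \<oplus> b \<oplus> \<one>"
  and times_zero: "a \<otimes> \<zero> = \<zero>"
  and times_plus_one: "a \<otimes> (b \<oplus> \<one>) = a \<otimes> b \<oplus> a"
  and not_less_zero: "\<not> a \<prec> \<zero>"
  and less_plus_one: "a \<prec> b \<oplus> \<one> \<longleftrightarrow> a \<prec> b \<or> a = b"
  using basic by (auto simp: basic_axioms_def)

lemma Sigma1_induct:
  assumes "is_Sigma 1 \<phi>" and "range s \<subseteq> sets \<MM>"
    and "sat \<MM> (e(x := \<zero>)) s \<phi>"
    and "\<And>a. sat \<MM> (e(x := a)) s \<phi> \<Longrightarrow> sat \<MM> (e(x := a \<oplus> \<one>)) s \<phi>"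
  shows "sat \<MM> (e(x := a)) s \<phi>"
proof -
  have "models_induction \<MM> \<phi>" using ISigma1 assms(1) by (simp add: models_ISigma_def)
  then show ?thesis using assms(2-4) unfolding models_induction_def by blast
qed

text \<open>Satisfaction needs an assignment of sets even where no set variable occurs. The
  hypotheses cover every assignment, the induction runs with a constant one into the model, and the
  conclusion keeps only that some assignment works.\<close>

lemma first_order_induct:
  assumes "is_Sigma 1 \<phi>"
    and "\<And>s. sat \<MM> (e(x := \<zero>)) s \<phi>"
    and "\<And>a s. sat \<MM> (e(x := a)) s \<phi> \<Longrightarrow> sat \<MM> (e(x := a \<oplus> \<one>)) s \<phi>"
  shows "\<exists>s. sat \<MM> (e(x := a)) s \<phi>"
proof -
  obtain A where "A \<in> sets \<MM>" using sets_nonempty by auto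
  then have "range (\<lambda>_::nat. A) \<subseteq> sets \<MM>" by auto
  from Sigma1_induct[OF assms(1) this assms(2) assms(3)] show ?thesis by blast
qed

lemmas Delta0_induct = first_order_induct[OF Delta0_is_Sigma1]

section \<open>Semiring laws from Delta_0 induction\<close>

lemma zero_plus: "\<zero> \<oplus> a = a"
  using Delta0_induct[of "Eq (Add Zero (Var 0)) (Var 0)" "\<lambda>_. a" 0 a]
  by (auto simp: plus_zero plus_plus_one)

lemma plus_one_plus: "a \<oplus> \<one> \<oplus> b = a \<oplus> b \<oplus> \<one>"
  using Delta0_induct[of "Eq (Add (Add (Var 1) One) (Var 0)) (Add (Add (Var 1) (Var 0)) One)"
      "\<lambda>_. a" 0 b]
  by (auto simp: plus_zero plus_plus_one)

lemma plus_commute: "a \<oplus> b = b \<oplus> a"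
  using Delta0_induct[of "Eq (Add (Var 1) (Var 0)) (Add (Var 0) (Var 1))" "\<lambda>_. a" 0 b]
  by (auto simp: plus_zero zero_plus plus_plus_one plus_one_plus)

lemma plus_assoc: "a \<oplus> b \<oplus> c = a \<oplus> (b \<oplus> c)"
  using Delta0_induct[of "Eq (Add (Add (Var 1) (Var 2)) (Var 0)) (Add (Var 1) (Add (Var 2) (Var 0)))"
      "(\<lambda>_. a)(2 := b)" 0 c]
  by (auto simp: plus_zero plus_plus_one)

lemma plus_right_cancel: "a \<oplus> c = b \<oplus> c \<longleftrightarrow> a = b"
  using Delta0_induct[of "Disj (Neg (Eq (Add (Var 1) (Var 0)) (Add (Var 2) (Var 0)))) (Eq (Var 1) (Var 2))"
      "(\<lambda>_. a)(2 := b)" 0 c]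
  by (auto simp: plus_zero plus_plus_one dest: plus_one_inject)

lemma zero_times: "\<zero> \<otimes> a = \<zero>"
  using Delta0_induct[of "Eq (Mul Zero (Var 0)) Zero" "\<lambda>_. a" 0 a]
  by (auto simp: times_zero times_plus_one plus_zero)

lemma plus_left_commute: "a \<oplus> (b \<oplus> c) = b \<oplus> (a \<oplus> c)"
  by (metis plus_assoc plus_commute)

lemma plus_one_times: "(a \<oplus> \<one>) \<otimes> b = a \<otimes> b \<oplus> b"
  using Delta0_induct[of "Eq (Mul (Add (Var 1) One) (Var 0)) (Add (Mul (Var 1) (Var 0)) (Var 0))"
      "\<lambda>_. a" 0 b]
  by (auto simp: plus_zero times_zero times_plus_one plus_assoc plus_left_commute)

lemma times_commute: "a \<otimes> b = b \<otimes> a"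
  using Delta0_induct[of "Eq (Mul (Var 1) (Var 0)) (Mul (Var 0) (Var 1))" "\<lambda>_. a" 0 b]
  by (auto simp: zero_times times_zero times_plus_one plus_one_times)

lemma distrib_left: "a \<otimes> (b \<oplus> c) = a \<otimes> b \<oplus> a \<otimes> c"
  using Delta0_induct[of "Eq (Mul (Var 1) (Add (Var 2) (Var 0))) (Add (Mul (Var 1) (Var 2)) (Mul (Var 1) (Var 0)))"
      "(\<lambda>_. a)(2 := b)" 0 c]
  by (auto simp: plus_zero times_zero times_plus_one plus_assoc[symmetric])

lemma times_one: "a \<otimes> \<one> = a"
  using times_plus_one[of a \<zero>] by (simp add: zero_plus times_zero)

lemma times_assoc: "a \<otimes> b \<otimes> c = a \<otimes> (b \<otimes> c)"
  using Delta0_induct[of "Eq (Mul (Mul (Var 1) (Var 2)) (Var 0)) (Mul (Var 1) (Mul (Var 2) (Var 0)))"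
      "(\<lambda>_. a)(2 := b)" 0 c]
  by (auto simp: times_zero times_plus_one distrib_left times_one)

section \<open>The order and truncated subtraction\<close>

lemma zero_or_plus_one: "a = \<zero> \<or> (\<exists>b. a = b \<oplus> \<one>)"
proof -
  have "\<exists>s. sat \<MM> ((\<lambda>_. a)(0 := a)) s (Ex 1 (Disj (Eq (Var 0) Zero) (Eq (Var 0) (Add (Var 1) One))))"
    by (rule first_order_induct[OF is_Sigma1_Ex[OF Delta0_is_Sigma1]]) auto
  then show ?thesis by auto
qed

text \<open>The axioms describe the order by recursion on its right argument; in additive form its
  properties become algebra. The difference \<open>c\<close> is found by Sigma_1 induction on
  \<open>b\<close>.\<close>

lemma less_iff_plus: "a \<prec> b \<longleftrightarrow> (\<exists>c. b = a \<oplus> c \<oplus> \<one>)"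
proof
  let ?\<phi> = "Ex 1 (Disj (Neg (Less (Var 2) (Var 0))) (Eq (Var 0) (Add (Add (Var 2) (Var 1)) One)))"
  have "\<exists>s. sat \<MM> ((\<lambda>_. a)(0 := b)) s ?\<phi>"
  proof (rule first_order_induct)
    show "is_Sigma 1 ?\<phi>" by (intro is_Sigma1_Ex Delta0_is_Sigma1) simp
  next
    fix b and s :: "nat \<Rightarrow> 'a set"
    assume "sat \<MM> ((\<lambda>_. a)(0 := b)) s ?\<phi>"
    then have "a \<prec> b \<Longrightarrow> \<exists>c. b = a \<oplus> c \<oplus> \<one>" by auto
    moreover have "a \<oplus> c \<oplus> \<one> \<oplus> \<one> = a \<oplus> (c \<oplus> \<one>) \<oplus> \<one>" for c by (simp only: plus_plus_one)
    moreover have "a \<oplus> \<one> = a \<oplus> \<zero> \<oplus> \<one>" by (simp only: plus_zero)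
    ultimately have "a \<prec> b \<oplus> \<one> \<Longrightarrow> \<exists>c. b \<oplus> \<one> = a \<oplus> c \<oplus> \<one>"
      unfolding less_plus_one by metis
    then show "sat \<MM> ((\<lambda>_. a)(0 := b \<oplus> \<one>)) s ?\<phi>" by auto
  qed (simp add: not_less_zero)
  then show "a \<prec> b \<Longrightarrow> \<exists>c. b = a \<oplus> c \<oplus> \<one>" by auto
next
  have "a \<prec> a \<oplus> c \<oplus> \<one>" for c
    using Delta0_induct[of "Less (Var 1) (Add (Add (Var 1) (Var 0)) One)" "\<lambda>_. a" 0 c]
    by (auto simp: plus_zero less_plus_one plus_plus_one)
  then show "\<exists>c. b = a \<oplus> c \<oplus> \<one> \<Longrightarrow> a \<prec> b" by auto
qed

lemma le_iff_plus: "a \<preceq> b \<longleftrightarrow> (\<exists>c. b = a \<oplus> c)"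
  using zero_or_plus_one plus_plus_one plus_zero unfolding leq_def less_iff_plus by metis

lemma less_linear: "a \<prec> b \<or> a = b \<or> b \<prec> a"
proof -
  have z: "\<zero> \<prec> b \<or> \<zero> = b" for b
    using zero_or_plus_one[of b] by (auto simp: less_iff_plus zero_plus)
  have s: "a \<oplus> \<one> \<prec> b \<or> a \<oplus> \<one> = b" if "a \<prec> b" for a b
  proof -
    from that obtain c where b: "b = a \<oplus> c \<oplus> \<one>" by (auto simp: less_iff_plus)
    show ?thesis
    proof (cases "c = \<zero>")
      case False
      then obtain d where "c = d \<oplus> \<one>" using zero_or_plus_one by blast
      then have "b = a \<oplus> \<one> \<oplus> d \<oplus> \<one>" by (simp only: b plus_plus_one plus_one_plus[of a d])
      then show ?thesis by (auto simp: less_iff_plus)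
    qed (simp add: b plus_zero)
  qed
  show ?thesis
    using Delta0_induct[of "Disj (Less (Var 0) (Var 1)) (Disj (Eq (Var 0) (Var 1)) (Less (Var 1) (Var 0)))"
        "\<lambda>_. b" 0 a] z s
    by (auto simp: less_plus_one)
qed

lemma less_irrefl: "\<not> a \<prec> a"
proof
  assume "a \<prec> a"
  then obtain c where "\<zero> \<oplus> a = c \<oplus> \<one> \<oplus> a"
    unfolding less_iff_plus zero_plus by (auto simp only: plus_assoc plus_commute[of a])
  then show False by (simp only: plus_right_cancel) (metis plus_one_neq_zero)
qed

lemma less_trans: "a \<prec> b \<Longrightarrow> b \<prec> c \<Longrightarrow> a \<prec> c" (is "_ \<Longrightarrow> _ \<Longrightarrow> ?thesis")
proof -
  assume "a \<prec> b" "b \<prec> c"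
  then obtain d e where "c = a \<oplus> (d \<oplus> \<one> \<oplus> e) \<oplus> \<one>"
    by (auto simp only: less_iff_plus plus_assoc)
  then show ?thesis unfolding less_iff_plus by blast
qed

text \<open>The class \<open>linordered_semidom\<close> has a difference among its operations, so
  one is supplied here; it also serves to cancel summands under divisibility.\<close>

definition minusM :: "'a \<Rightarrow> 'a \<Rightarrow> 'a" where
  "minusM a b = (if b \<preceq> a then THE c. a = b \<oplus> c else \<zero>)"

lemma minusM_plus: "minusM (a \<oplus> b) a = b"
  unfolding minusM_def le_iff_plus by (auto simp: plus_commute[of a] plus_right_cancel)

lemma not_le_minusM: "\<not> b \<preceq> a \<Longrightarrow> minusM a b = \<zero>"
  by (simp add: minusM_def)

lemma minusM_minusM: "minusM (minusM a b) c = minusM a (b \<oplus> c)"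
proof (cases "b \<preceq> a")
  case True
  then obtain d where d: "a = b \<oplus> d" by (auto simp: le_iff_plus)
  show ?thesis
  proof (cases "c \<preceq> d")
    case True
    then obtain e where "d = c \<oplus> e" by (auto simp: le_iff_plus)
    then show ?thesis by (simp add: d minusM_plus plus_assoc[symmetric])
        (simp add: minusM_plus plus_assoc)
  next
    case False
    then have "\<not> b \<oplus> c \<preceq> a"
      unfolding d le_iff_plus by (metis plus_assoc plus_commute plus_right_cancel)
    with False show ?thesis by (simp add: d minusM_plus not_le_minusM)
  qed
next
  case False
  then have "\<not> b \<oplus> c \<preceq> a" unfolding le_iff_plus by (metis plus_assoc)
  moreover have "minusM \<zero> c = \<zero>"
    by (cases "c = \<zero>") (metis minusM_plus plus_zero, simp add: leq_def not_less_zero not_le_minusM)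
  ultimately show ?thesis using False by (simp add: not_le_minusM)
qed

lemma times_minusM: "a \<otimes> minusM b c = minusM (a \<otimes> b) (a \<otimes> c)"
proof (cases "c \<preceq> b")
  case True
  then show ?thesis unfolding le_iff_plus by (auto simp: minusM_plus distrib_left)
next
  case False
  then obtain d where "c = b \<oplus> d" using less_linear[of b c] by (metis leq_def le_iff_plus)
  then have "a \<otimes> c = a \<otimes> b \<oplus> a \<otimes> d" by (simp add: distrib_left)
  then have "minusM (a \<otimes> b) (a \<otimes> c) = \<zero>"
    by (metis minusM_minusM minusM_plus not_le_minusM plus_zero leq_def not_less_zero)
  then show ?thesis using False by (simp add: not_le_minusM times_zero)
qed

sublocale M: linordered_semidom plusM minusM leM lessM zeroM timesM oneM
proof
  fix a b c x y z
  show "a \<oplus> b \<oplus> c = a \<oplus> (b \<oplus> c)" by (rule plus_assoc)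
  show "a \<oplus> b = b \<oplus> a" by (rule plus_commute)
  show "minusM (a \<oplus> b) a = b" by (rule minusM_plus)
  show "minusM (minusM a b) c = minusM a (b \<oplus> c)" by (rule minusM_minusM)
  show "x \<prec> y \<longleftrightarrow> x \<preceq> y \<and> \<not> y \<preceq> x"
    unfolding leq_def using less_irrefl less_trans by blast
  show "x \<preceq> x" by (simp add: leq_def)
  show "x \<preceq> y \<Longrightarrow> y \<preceq> z \<Longrightarrow> x \<preceq> z" unfolding leq_def using less_trans by blast
  show "x \<preceq> y \<Longrightarrow> y \<preceq> x \<Longrightarrow> x = y" unfolding leq_def using less_irrefl less_trans by blast
  show "a \<preceq> b \<Longrightarrow> c \<oplus> a \<preceq> c \<oplus> b" unfolding le_iff_plus by (metis plus_assoc)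
  show "x \<preceq> y \<or> y \<preceq> x" unfolding leq_def using less_linear by blast
  show "\<zero> \<oplus> a = a" by (rule zero_plus)
  show "a \<otimes> b \<otimes> c = a \<otimes> (b \<otimes> c)" by (rule times_assoc)
  show "a \<otimes> b = b \<otimes> a" by (rule times_commute)
  show "\<one> \<otimes> a = a" by (metis times_commute times_one)
  show "(a \<oplus> b) \<otimes> c = a \<otimes> c \<oplus> b \<otimes> c" by (metis times_commute distrib_left)
  show "\<zero> \<otimes> a = \<zero>" by (rule zero_times)
  show "\<zero> \<noteq> \<one>" using plus_one_neq_zero[of \<zero>] by (simp add: zero_plus)
  show "a \<otimes> minusM b c = minusM (a \<otimes> b) (a \<otimes> c)" by (rule times_minusM)
  show "a \<noteq> \<zero> \<Longrightarrow> b \<noteq> \<zero> \<Longrightarrow> a \<otimes> b \<noteq> \<zero>"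
    by (metis zero_or_plus_one times_plus_one plus_plus_one plus_one_neq_zero)
  show "\<zero> \<prec> \<one>" using zero_plus less_iff_plus by metis
  show "b \<preceq> a \<Longrightarrow> minusM a b \<oplus> b = a"
    unfolding le_iff_plus by (metis minusM_plus plus_commute)
  show "a \<prec> b \<Longrightarrow> \<zero> \<prec> c \<Longrightarrow> c \<otimes> a \<prec> c \<otimes> b"
    unfolding less_iff_plus zero_plus
    by (metis distrib_left plus_assoc plus_plus_one times_plus_one)
qed (simp_all add: times_zero distrib_left)

end

section \<open>Decidable sets and computable functions\<close>

text \<open>A polynomial pairing is denoted by a term, so pairs can be formed inside bounded
  formulas; the pairing of the theorem only has a Sigma_1 graph. This one is injective but not
  onto.\<close>

definition tpr :: "tm \<Rightarrow> tm \<Rightarrow> tm" where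
  "tpr t u = Add (Mul (Add t u) (Add t u)) t"

lemma tm_vars_tpr [simp]: "tm_vars (tpr t u) = tm_vars t \<union> tm_vars u"
  by (auto simp: tpr_def)

context rca_model
begin

section \<open>The polynomial pairing function\<close>

lemmas semiring_simps =
  M.add.assoc M.add.commute M.add.left_commute M.mult.assoc M.mult.commute M.mult.left_commute
  M.distrib_left M.distrib_right times_one

definition pr :: "'a \<Rightarrow> 'a \<Rightarrow> 'a" where
  "pr a b = (a \<oplus> b) \<otimes> (a \<oplus> b) \<oplus> a"

lemma tm_val_tpr [simp]: "tm_val (numbers \<MM>) e (tpr t u) = pr (tm_val (numbers \<MM>) e t) (tm_val (numbers \<MM>) e u)"
  by (simp add: tpr_def pr_def)

lemma zero_le: "\<zero> \<preceq> a"
  by (simp add: le_iff_plus zero_plus)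

lemma le_plus: "a \<preceq> a \<oplus> b" "b \<preceq> a \<oplus> b"
  by (auto simp: le_iff_plus plus_commute)

lemma less_plus_one_iff_le: "a \<prec> b \<oplus> \<one> \<longleftrightarrow> a \<preceq> b"
  by (simp add: less_plus_one leq_def)

lemma pr_less:
  assumes "a \<oplus> b \<prec> c \<oplus> d"
  shows "pr a b \<prec> pr c d"
proof -
  define s where "s = a \<oplus> b"
  obtain e where e: "c \<oplus> d = s \<oplus> e \<oplus> \<one>" using assms by (auto simp: less_iff_plus s_def)
  \<comment> \<open>\<open>r\<close> is what remains of the square of \<open>s + e + 1\<close>, plus
    \<open>c\<close>, after splitting off the square of \<open>s\<close>, \<open>s\<close> and
    \<open>1\<close>.\<close>
  define r where "r = s \<oplus> e \<otimes> e \<oplus> e \<oplus> e \<oplus> e \<otimes> s \<oplus> e \<otimes> s \<oplus> c"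
  have "pr c d = s \<otimes> s \<oplus> s \<oplus> r \<oplus> \<one>"
    unfolding pr_def e r_def by (simp add: semiring_simps)
  also have "\<dots> = pr a b \<oplus> (b \<oplus> r) \<oplus> \<one>"
    by (simp add: pr_def plus_assoc flip: s_def) (simp add: s_def plus_assoc)
  finally show ?thesis by (auto simp: less_iff_plus)
qed

lemma pr_inject [simp]: "pr a b = pr c d \<longleftrightarrow> a = c \<and> b = d"
proof
  assume eq: "pr a b = pr c d"
  have "a \<oplus> b = c \<oplus> d"
    using less_linear[of "a \<oplus> b" "c \<oplus> d"] pr_less[of a b c d] pr_less[of c d a b] eq
    by (auto simp: less_irrefl)
  with eq show "a = c \<and> b = d" by (simp add: pr_def)
qed simp

lemma le_pr1: "a \<preceq> pr a b"
  by (auto simp: pr_def le_iff_plus plus_commute)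

lemma le_pr2: "b \<preceq> pr a b"
proof (cases "b = \<zero>")
  case False
  then obtain c where b: "b = c \<oplus> \<one>" using zero_or_plus_one by blast
  have "pr a b = b \<oplus> (a \<otimes> a \<oplus> a \<otimes> b \<oplus> a \<otimes> b \<oplus> b \<otimes> c \<oplus> a)"
    unfolding pr_def b by (simp add: semiring_simps)
  then show ?thesis by (auto simp: le_iff_plus)
qed (simp add: zero_le)

definition pi1 :: "'a \<Rightarrow> 'a" where
  "pi1 z = (if \<exists>a b. z = pr a b then THE a. \<exists>b. z = pr a b else \<zero>)"

definition pi2 :: "'a \<Rightarrow> 'a" where
  "pi2 z = (if \<exists>a b. z = pr a b then THE b. \<exists>a. z = pr a b else \<zero>)"

lemma pi1_pr [simp]: "pi1 (pr a b) = a"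
  and pi2_pr [simp]: "pi2 (pr a b) = b"
  by (auto simp: pi1_def pi2_def)

text \<open>Predicates and functions that the model itself possesses. Their closure properties
  replace explicit formulas in everything that follows.\<close>

definition dec :: "('a \<Rightarrow> bool) \<Rightarrow> bool" where
  "dec P \<longleftrightarrow> {x. P x} \<in> sets \<MM>"

definition cf :: "('a \<Rightarrow> 'a) \<Rightarrow> bool" where
  "cf f \<longleftrightarrow> dec (\<lambda>x. \<exists>a. x = pr a (f a))"

lemma dec_Delta1:
  assumes "is_Sigma 1 \<phi>" and "is_Pi 1 \<psi>" and "range s \<subseteq> sets \<MM>"
    and "\<And>a. sat \<MM> (e(x := a)) s \<phi> \<longleftrightarrow> P a" and "\<And>a. sat \<MM> (e(x := a)) s \<psi> \<longleftrightarrow> P a"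
  shows "dec P"
proof -
  have "{a. sat \<MM> (e(x := a)) s \<phi>} \<in> sets \<MM>"
    using Delta1_CA assms unfolding models_Delta1_CA_def by blast
  then show ?thesis by (simp add: assms(4) dec_def)
qed

lemma dec_Delta0:
  assumes "Delta0 \<phi>" and "range s \<subseteq> sets \<MM>" and "\<And>a. sat \<MM> (e(x := a)) s \<phi> \<longleftrightarrow> P a"
  shows "dec P"
  using dec_Delta1[OF Delta0_is_Sigma1 Delta0_is_Pi1] assms by blast

lemma dec_False: "dec (\<lambda>x. False)"
proof -
  obtain A where "A \<in> sets \<MM>" using sets_nonempty by auto
  then show ?thesis
    by (intro dec_Delta0[where \<phi> = "Neg (Eq Zero Zero)" and s = "\<lambda>_. A"]) auto
qed

lemma dec_not: "dec P \<Longrightarrow> dec (\<lambda>x. \<not> P x)"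
  by (rule dec_Delta0[where \<phi> = "Neg (Mem (Var 0) 0)" and s = "\<lambda>_. {x. P x}" and x = 0])
    (auto simp: dec_def)

lemma dec_conj: "dec P \<Longrightarrow> dec Q \<Longrightarrow> dec (\<lambda>x. P x \<and> Q x)"
  by (rule dec_Delta0[where \<phi> = "Conj (Mem (Var 0) 0) (Mem (Var 0) 1)" and x = 0
        and s = "(\<lambda>_. {x. P x})(1 := {x. Q x})"])
    (auto simp: dec_def)

lemma dec_disj: "dec P \<Longrightarrow> dec Q \<Longrightarrow> dec (\<lambda>x. P x \<or> Q x)"
  using dec_not[OF dec_conj[OF dec_not[of P] dec_not[of Q]]] by simp

lemma dec_imp: "dec P \<Longrightarrow> dec Q \<Longrightarrow> dec (\<lambda>x. P x \<longrightarrow> Q x)"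
  using dec_disj[OF dec_not[of P], of Q] by (simp only: imp_conv_disj)

lemma dec_iff: "dec P \<Longrightarrow> dec Q \<Longrightarrow> dec (\<lambda>x. P x \<longleftrightarrow> Q x)"
  using dec_conj[OF dec_imp[of P Q] dec_imp[of Q P]] by (simp only: iff_conv_conj_imp)

lemma dec_bool: "dec (\<lambda>x. b)"
  using dec_False dec_not[OF dec_False] by (cases b) auto

text \<open>A total function with a \<open>\<Sigma>\<^sub>1\<close> graph has a \<open>\<Delta>\<^sub>1\<close> graph.\<close>

lemma cf_graph:
  assumes "Delta0 \<phi>" and "range s \<subseteq> sets \<MM>"
    and graph: "\<And>x y e. (\<exists>w. sat \<MM> (e(0 := x, 1 := y, 2 := w)) s \<phi>) \<longleftrightarrow> y = f x"
  shows "cf f"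
  unfolding cf_def
proof (rule dec_Delta1)
  \<comment> \<open>The Pi form says that the number is a pair and that, whenever
    \<open>\<phi>\<close> confirms \<open>y\<close> as the value at \<open>x\<close>, a component
    paired with \<open>x\<close> equals \<open>y\<close>. Totality of \<open>f\<close> makes it
    equivalent to the Sigma form.\<close>
  let ?\<phi> = "Ex 0 (Ex 1 (Ex 2 (Conj (Eq (Var 3) (tpr (Var 0) (Var 1))) \<phi>)))"
  let ?\<psi> = "All 0 (All 1 (All 2 (Conj
     (BEx 4 (Add (Var 3) One) (BEx 5 (Add (Var 3) One) (Eq (Var 3) (tpr (Var 4) (Var 5)))))
     (Disj (Neg \<phi>) (BAll 4 (Add (Var 3) One)
        (Disj (Neg (Eq (Var 3) (tpr (Var 0) (Var 4)))) (Eq (Var 4) (Var 1))))))))"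
  show "is_Sigma 1 ?\<phi>" "is_Pi 1 ?\<psi>"
    using assms(1) by (intro is_Sigma1_Ex is_Pi1_All Delta0_is_Sigma1 Delta0_is_Pi1; simp)+
  show "range s \<subseteq> sets \<MM>" by fact
  fix a and e :: "nat \<Rightarrow> 'a"
  show "sat \<MM> (e(3 := a)) s ?\<phi> \<longleftrightarrow> (\<exists>x. a = pr x (f x))"
    using graph[of "e(3 := a)"] by auto
  have "sat \<MM> (e(3 := a)) s ?\<psi> \<longleftrightarrow> (\<exists>x y. a = pr x y) \<and> (\<forall>x y. a = pr x y \<longrightarrow> y = f x)"
    using graph[of "e(3 := a)"]
    by (auto simp: less_plus_one_iff_le le_pr1 le_pr2)
  then show "sat \<MM> (e(3 := a)) s ?\<psi> \<longleftrightarrow> (\<exists>x. a = pr x (f x))" by auto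
qed

section \<open>Closure properties of computable functions and decidable predicates\<close>

lemma cf_graph_member: "cf f \<Longrightarrow> {x. \<exists>a. x = pr a (f a)} \<in> sets \<MM>"
  by (simp add: cf_def dec_def)

lemma cf_id: "cf (\<lambda>x. x)"
proof -
  obtain A where "A \<in> sets \<MM>" using sets_nonempty by auto
  then show ?thesis
    by (intro cf_graph[where \<phi> = "Eq (Var 1) (Var 0)" and s = "\<lambda>_. A"]) auto
qed

lemma cf_const: "cf (\<lambda>x. c)"
proof -
  obtain A where "A \<in> sets \<MM>" using sets_nonempty by auto
  then show ?thesis unfolding cf_def
    by (intro dec_Delta0[where x = 0 and e = "\<lambda>_. c" and s = "\<lambda>_. A"
          and \<phi> = "BEx 1 (Add (Var 0) One) (Eq (Var 0) (tpr (Var 1) (Var 2)))"])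
      (auto simp: less_plus_one_iff_le le_pr1)
qed

lemma cf_tm2:
  assumes "cf f" and "cf g" and "tm_vars t \<subseteq> {10, 11}"
    and "\<And>e. tm_val (numbers \<MM>) e t = h (e 10) (e 11)"
  shows "cf (\<lambda>x. h (f x) (g x))"
proof (rule cf_graph)
  \<comment> \<open>The single witness \<open>Var 2\<close> is the pair of both values. They are
    recovered by bounded quantifiers, which keeps the matrix Delta_0.\<close>
  let ?\<phi> = "BEx 10 (Add (Var 2) One) (BEx 11 (Add (Var 2) One)
    (Conj (Eq (Var 2) (tpr (Var 10) (Var 11))) (Conj (Mem (tpr (Var 0) (Var 10)) 0)
      (Conj (Mem (tpr (Var 0) (Var 11)) 1) (Eq (Var 1) t)))))"
  let ?s = "(\<lambda>_. {x. \<exists>a. x = pr a (f a)})(1 := {x. \<exists>a. x = pr a (g a)})"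
  show "Delta0 ?\<phi>" by simp
  show "range ?s \<subseteq> sets \<MM>" using assms(1,2) by (auto dest: cf_graph_member)
  show "(\<exists>w. sat \<MM> (e(0 := x, 1 := y, 2 := w)) ?s ?\<phi>) \<longleftrightarrow> y = h (f x) (g x)" for x y e
    by (auto simp: assms(4) less_plus_one_iff_le le_pr1 le_pr2)
qed

lemma cf_plus: "cf f \<Longrightarrow> cf g \<Longrightarrow> cf (\<lambda>x. f x \<oplus> g x)"
  and cf_times: "cf f \<Longrightarrow> cf g \<Longrightarrow> cf (\<lambda>x. f x \<otimes> g x)"
  and cf_pr: "cf f \<Longrightarrow> cf g \<Longrightarrow> cf (\<lambda>x. pr (f x) (g x))"
  using cf_tm2[of f g "Add (Var 10) (Var 11)"] cf_tm2[of f g "Mul (Var 10) (Var 11)"]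
    cf_tm2[of f g "tpr (Var 10) (Var 11)"] by auto

lemma cf_comp:
  assumes "cf f" and "cf g"
  shows "cf (\<lambda>x. f (g x))"
proof (rule cf_graph)
  let ?\<phi> = "Conj (Mem (tpr (Var 0) (Var 2)) 1) (Mem (tpr (Var 2) (Var 1)) 0)"
  let ?s = "(\<lambda>_. {x. \<exists>a. x = pr a (f a)})(1 := {x. \<exists>a. x = pr a (g a)})"
  show "Delta0 ?\<phi>" by simp
  show "range ?s \<subseteq> sets \<MM>" using assms by (auto dest: cf_graph_member)
  show "(\<exists>w. sat \<MM> (e(0 := x, 1 := y, 2 := w)) ?s ?\<phi>) \<longleftrightarrow> y = f (g x)" for x y e
    by auto
qed

lemma cf_pi: "cf pi1" "cf pi2"
proof -
  obtain A where A: "A \<in> sets \<MM>" using sets_nonempty by auto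
  \<comment> \<open>Off the range of \<open>pr\<close> the projections take the default value
    zero.\<close>
  let ?np = "Conj (Neg (BEx 4 (Add (Var 0) One) (BEx 5 (Add (Var 0) One)
     (Eq (Var 0) (tpr (Var 4) (Var 5)))))) (Eq (Var 1) Zero)"
  have np: "sat \<MM> e s ?np \<longleftrightarrow> e 1 = \<zero> \<and> \<not> (\<exists>a b. e 0 = pr a b)" for e s
    by (auto simp: less_plus_one_iff_le) (metis le_pr1 le_pr2)
  show "cf pi1"
    by (rule cf_graph[where \<phi> = "Disj (Eq (Var 0) (tpr (Var 1) (Var 2))) ?np" and s = "\<lambda>_. A"])
      (use A np in \<open>auto simp: pi1_def simp del: sat.simps(4,5,7,8)\<close>)
  show "cf pi2"
    by (rule cf_graph[where \<phi> = "Disj (Eq (Var 0) (tpr (Var 2) (Var 1))) ?np" and s = "\<lambda>_. A"])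
      (use A np in \<open>auto simp: pi2_def simp del: sat.simps(4,5,7,8)\<close>)
qed

lemmas cf_pi1 = cf_comp[OF cf_pi(1)] and cf_pi2 = cf_comp[OF cf_pi(2)]

lemma dec_comp:
  assumes "dec P" and "cf f"
  shows "dec (\<lambda>x. P (f x))"
proof (rule dec_Delta1)
  let ?s = "(\<lambda>_. {x. \<exists>a. x = pr a (f a)})(1 := {x. P x})"
  let ?\<phi> = "Ex 1 (Conj (Mem (tpr (Var 0) (Var 1)) 0) (Mem (Var 1) 1))"
  let ?\<psi> = "All 1 (Disj (Neg (Mem (tpr (Var 0) (Var 1)) 0)) (Mem (Var 1) 1))"
  show "is_Sigma 1 ?\<phi>" "is_Pi 1 ?\<psi>"
    by (intro is_Sigma1_Ex is_Pi1_All Delta0_is_Sigma1 Delta0_is_Pi1; simp)+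
  show "range ?s \<subseteq> sets \<MM>" using assms by (auto simp: dec_def dest: cf_graph_member)
  show "sat \<MM> (e(0 := a)) ?s ?\<phi> \<longleftrightarrow> P (f a)" "sat \<MM> (e(0 := a)) ?s ?\<psi> \<longleftrightarrow> P (f a)" for e a
    by auto
qed

lemma dec_less: "cf f \<Longrightarrow> cf g \<Longrightarrow> dec (\<lambda>x. f x \<prec> g x)"
  and dec_eq: "cf f \<Longrightarrow> cf g \<Longrightarrow> dec (\<lambda>x. f x = g x)"
proof -
  obtain A where A: "A \<in> sets \<MM>" using sets_nonempty by auto
  let ?\<phi> = "\<lambda>\<chi>. BEx 1 (Add (Var 0) One) (BEx 2 (Add (Var 0) One)
    (Conj (Eq (Var 0) (tpr (Var 1) (Var 2))) \<chi>))"
  have less: "dec (\<lambda>x. \<exists>a b. x = pr a b \<and> a \<prec> b)"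
    by (rule dec_Delta0[where \<phi> = "?\<phi> (Less (Var 1) (Var 2))" and x = 0 and s = "\<lambda>_. A"])
      (use A in \<open>auto simp: less_plus_one_iff_le le_pr1 le_pr2\<close>)
  have eq: "dec (\<lambda>x. \<exists>a b. x = pr a b \<and> a = b)"
    by (rule dec_Delta0[where \<phi> = "?\<phi> (Eq (Var 1) (Var 2))" and x = 0 and s = "\<lambda>_. A"])
      (use A in \<open>auto simp: less_plus_one_iff_le le_pr1 le_pr2\<close>)
  assume "cf f" "cf g"
  then have cf: "cf (\<lambda>x. pr (f x) (g x))" by (rule cf_pr)
  show "dec (\<lambda>x. f x \<prec> g x)" "dec (\<lambda>x. f x = g x)"
    using dec_comp[OF less cf] dec_comp[OF eq cf] by auto
qed

lemmas cf_intros = cf_id cf_const cf_plus cf_times cf_pr cf_pi1 cf_pi2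
lemmas dec_prop_intros = dec_bool dec_not dec_conj dec_disj dec_imp dec_iff dec_less dec_eq

lemma dec_ball:
  assumes "dec (\<lambda>z. P (pi1 z) (pi2 z))" and "cf b"
  shows "dec (\<lambda>x. \<forall>y. y \<prec> b x \<longrightarrow> P x y)"
proof -
  \<comment> \<open>The number \<open>w = pr x (b x)\<close> carries the argument and the bound
    together and is at least as large as the bound. So it suffices to quantify over \<open>y\<close>
    below the variable \<open>w\<close> and to let \<open>?C\<close> ignore the \<open>y\<close>
    that are too large.\<close>
  let ?C = "\<lambda>z. pi2 z \<prec> pi2 (pi1 z) \<longrightarrow> P (pi1 (pi1 z)) (pi2 z)"
  have "dec (\<lambda>z. P (pi1 (pi1 z)) (pi2 z))"
    using dec_comp[OF assms(1), of "\<lambda>z. pr (pi1 (pi1 z)) (pi2 z)"] by (simp add: cf_intros)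
  then have "dec ?C" by (intro dec_prop_intros cf_intros)
  then have "dec (\<lambda>w. \<forall>y. y \<prec> w \<longrightarrow> ?C (pr w y))"
    by (intro dec_Delta0[where x = 0 and s = "\<lambda>_. {z. ?C z}"
          and \<phi> = "BAll 1 (Var 0) (Mem (tpr (Var 0) (Var 1)) 0)"])
      (auto simp: dec_def)
  then have "dec (\<lambda>x. \<forall>y. y \<prec> pr x (b x) \<longrightarrow> ?C (pr (pr x (b x)) y))"
    by (rule dec_comp) (intro cf_intros assms(2))
  moreover have "y \<prec> pr x (b x)" if "y \<prec> b x" for x y
    using that le_pr2[of "b x" x] M.less_le_trans by blast
  then have "(\<lambda>x. \<forall>y. y \<prec> pr x (b x) \<longrightarrow> ?C (pr (pr x (b x)) y)) = (\<lambda>x. \<forall>y. y \<prec> b x \<longrightarrow> P x y)"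
    by (auto simp: fun_eq_iff)
  ultimately show ?thesis by metis
qed

lemma dec_bex:
  assumes "dec (\<lambda>z. P (pi1 z) (pi2 z))" and "cf b"
  shows "dec (\<lambda>x. \<exists>y. y \<prec> b x \<and> P x y)"
  using dec_not[OF dec_ball[OF dec_not[OF assms(1)] assms(2)]] by simp

end

section \<open>The arithmetical hierarchy over a class of sets\<close>

lemma tm_val_fun_upd [simp]: "x \<notin> tm_vars t \<Longrightarrow> tm_val N (e(x := a)) t = tm_val N e t"
  by (induction t) auto

text \<open>Pi relations are represented as negated Sigma relations, so one recursion serves both,
  and the pairing \<open>q\<close> contracts a block of quantifiers into one. The class
  \<open>D\<close> of matrices is a parameter, as it will be \<open>dec\<close> in the ground model
  and \<open>D1\<close> in the extension.\<close>

primrec Sgm :: "(('a \<Rightarrow> bool) \<Rightarrow> bool) \<Rightarrow> ('a \<Rightarrow> 'a \<Rightarrow> 'a) \<Rightarrow> nat \<Rightarrow> ('a \<Rightarrow> bool) \<Rightarrow> bool" where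
  "Sgm D q 0 P \<longleftrightarrow> D P"
| "Sgm D q (Suc k) P \<longleftrightarrow> (\<exists>Q. Sgm D q k Q \<and> P = (\<lambda>x. \<exists>y. \<not> Q (q x y)))"

context rca_model
begin

text \<open>These are the closure properties that an induction on Delta_0 formulas demands.
  Substitutions and bounds come from functions of the ground model, because terms have the same
  values in the extension.\<close>

definition Delta0_closed :: "(('a \<Rightarrow> bool) \<Rightarrow> bool) \<Rightarrow> bool" where
  "Delta0_closed D \<longleftrightarrow>
     (\<forall>P. dec P \<longrightarrow> D P) \<and> (\<forall>P. D P \<longrightarrow> D (\<lambda>x. \<not> P x)) \<and>
     (\<forall>P Q. D P \<longrightarrow> D Q \<longrightarrow> D (\<lambda>x. P x \<and> Q x)) \<and>
     (\<forall>P f. D P \<longrightarrow> cf f \<longrightarrow> D (\<lambda>x. P (f x))) \<and>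
     (\<forall>P b. D P \<longrightarrow> cf b \<longrightarrow> D (\<lambda>x. \<forall>y. y \<prec> b x \<longrightarrow> P (pr x y)))"

lemma Delta0_closedD:
  assumes "Delta0_closed D"
  shows "dec P \<Longrightarrow> D P" and "D P \<Longrightarrow> D (\<lambda>x. \<not> P x)"
    and "D P \<Longrightarrow> D Q \<Longrightarrow> D (\<lambda>x. P x \<and> Q x)" and "D P \<Longrightarrow> cf f \<Longrightarrow> D (\<lambda>x. P (f x))"
    and "D P \<Longrightarrow> cf b \<Longrightarrow> D (\<lambda>x. \<forall>y. y \<prec> b x \<longrightarrow> P (pr x y))"
  using assms unfolding Delta0_closed_def by blast+

lemma Delta0_closed_disj:
  assumes "Delta0_closed D" and "D P" and "D Q"
  shows "D (\<lambda>x. P x \<or> Q x)"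
proof -
  have "D (\<lambda>x. \<not> (\<not> P x \<and> \<not> Q x))" by (intro Delta0_closedD(2,3)[OF assms(1)] assms(2,3))
  then show ?thesis by simp
qed

lemma Delta0_closed_dec: "Delta0_closed dec"
proof -
  have "dec (\<lambda>x. \<forall>y. y \<prec> b x \<longrightarrow> P (pr x y))" if "dec P" "cf b" for P b
    by (rule dec_ball[OF dec_comp[OF that(1)] that(2)]) (intro cf_intros)
  then show ?thesis
    unfolding Delta0_closed_def by (blast intro: dec_not dec_conj dec_comp)
qed

abbreviation Sig :: "(('a \<Rightarrow> bool) \<Rightarrow> bool) \<Rightarrow> nat \<Rightarrow> ('a \<Rightarrow> bool) \<Rightarrow> bool" where
  "Sig D \<equiv> Sgm D pr"

lemma SigI:
  assumes "Sig D k Q" and "\<And>x. P x \<longleftrightarrow> (\<exists>y. \<not> Q (pr x y))"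
  shows "Sig D (Suc k) P"
  using assms by (auto intro!: exI[of _ Q] ext)

context
  fixes D
  assumes closed: "Delta0_closed D"
begin

lemma Sig_comp: "Sig D k P \<Longrightarrow> cf f \<Longrightarrow> Sig D k (\<lambda>x. P (f x))"
proof (induction k arbitrary: P f)
  case 0
  then show ?case using Delta0_closedD(4)[OF closed] by simp
next
  case (Suc k)
  then obtain Q where Q: "Sig D k Q" "P = (\<lambda>x. \<exists>y. \<not> Q (pr x y))" by auto
  have "cf (\<lambda>z. pr (f (pi1 z)) (pi2 z))" by (intro cf_intros cf_comp[OF Suc.prems(2)])
  from Suc.IH[OF Q(1) this] show ?case
    unfolding Sgm.simps Q(2) by (intro exI conjI) auto
qed

lemma Sig_not: "Sig D k P \<Longrightarrow> Sig D (Suc k) (\<lambda>x. \<not> P x)"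
  using Sig_comp[of k P pi1] cf_pi(1) by (auto intro!: exI[of _ "\<lambda>z. P (pi1 z)"])

lemma Sig_ex:
  assumes "Sig D (Suc k) P"
  shows "Sig D (Suc k) (\<lambda>x. \<exists>a. P (pr x a))"
proof -
  from assms obtain Q where Q: "Sig D k Q" "P = (\<lambda>x. \<exists>y. \<not> Q (pr x y))" by auto
  let ?f = "\<lambda>z. pr (pr (pi1 z) (pi1 (pi2 z))) (pi2 (pi2 z))"
  have "Sig D k (\<lambda>z. Q (?f z))" by (rule Sig_comp[OF Q(1)]) (intro cf_intros)
  moreover have "(\<exists>a. P (pr x a)) \<longleftrightarrow> (\<exists>y. \<not> Q (?f (pr x y)))" for x
    unfolding Q(2) by (metis pi1_pr pi2_pr)
  ultimately show ?thesis by (auto intro!: exI[of _ "\<lambda>z. Q (?f z)"])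
qed

text \<open>Both connectives are treated at once, since each level of the hierarchy sits under a
  negation, which exchanges them.\<close>

lemma Sig_conj_disj:
  "Sig D k P \<Longrightarrow> D R \<Longrightarrow> Sig D k (\<lambda>x. P x \<and> R x) \<and> Sig D k (\<lambda>x. P x \<or> R x)"
proof (induction k arbitrary: P R)
  case 0
  then show ?case using Delta0_closedD(3)[OF closed] Delta0_closed_disj[OF closed] by simp
next
  case (Suc k)
  then obtain Q where Q: "Sig D k Q" "P = (\<lambda>x. \<exists>y. \<not> Q (pr x y))" by auto
  have "D (\<lambda>z. \<not> R (pi1 z))"
    using Delta0_closedD(4)[OF closed Delta0_closedD(2)[OF closed Suc.prems(2)] cf_pi(1)] .
  note IH = Suc.IH[OF Q(1) this]
  have "\<exists>Q'. Sig D k Q' \<and> (\<lambda>x. P x \<and> R x) = (\<lambda>x. \<exists>y. \<not> Q' (pr x y))"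
    by (rule exI, rule conjI, rule conjunct2[OF IH]) (auto simp: Q(2))
  moreover have "\<exists>Q'. Sig D k Q' \<and> (\<lambda>x. P x \<or> R x) = (\<lambda>x. \<exists>y. \<not> Q' (pr x y))"
    by (rule exI, rule conjI, rule conjunct1[OF IH]) (auto simp: Q(2))
  ultimately show ?case by simp
qed

lemmas Sig_conj = conjunct1[OF Sig_conj_disj]

end

section \<open>Passage between formulas and relations\<close>

lemma cf_tm_val: "(\<And>v. cf (E v)) \<Longrightarrow> cf (\<lambda>x. tm_val (numbers \<MM>) (\<lambda>v. E v x) t)"
  by (induction t) (auto intro: cf_intros)

text \<open>An assignment depending on a number is extended by a fresh value by pairing.\<close>

definition env_upd :: "(nat \<Rightarrow> 'a \<Rightarrow> 'a) \<Rightarrow> nat \<Rightarrow> nat \<Rightarrow> 'a \<Rightarrow> 'a" where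
  "env_upd E u = (\<lambda>v. if v = u then pi2 else (\<lambda>z. E v (pi1 z)))"

lemma cf_env_upd: "(\<And>v. cf (E v)) \<Longrightarrow> cf (env_upd E u v)"
  by (auto simp: env_upd_def intro: cf_pi cf_comp)

lemma env_upd_pr: "(\<lambda>v. env_upd E u v (pr x a)) = (\<lambda>v. E v x)(u := a)"
  by (auto simp: env_upd_def fun_eq_iff)

context
  fixes D and \<NN> :: "'a so_model" and s :: "nat \<Rightarrow> 'a set"
  assumes closed: "Delta0_closed D" and numbers: "numbers \<NN> = numbers \<MM>"
    and s: "\<And>X. D (\<lambda>x. x \<in> s X)"
begin

lemma sat_Delta0:
  "Delta0 \<phi> \<Longrightarrow> (\<And>v. cf (E v)) \<Longrightarrow> D (\<lambda>x. sat \<NN> (\<lambda>v. E v x) s \<phi>)"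
proof (induction arbitrary: E rule: Delta0.induct)
  case (1 t u)
  then show ?case
    by (auto simp: numbers intro!: Delta0_closedD(1)[OF closed] dec_eq cf_tm_val)
next
  case (2 t u)
  then show ?case
    by (auto simp: numbers intro!: Delta0_closedD(1)[OF closed] dec_less cf_tm_val)
next
  case (3 t X)
  then show ?case
    using Delta0_closedD(4)[OF closed s cf_tm_val] by (simp add: numbers)
next
  case (4 \<phi>)
  then show ?case by (auto intro!: Delta0_closedD(2)[OF closed])
next
  case (5 \<phi> \<psi>)
  then show ?case by (auto intro!: Delta0_closedD(3)[OF closed])
next
  case (6 \<phi> \<psi>)
  then show ?case by (auto intro!: Delta0_closed_disj[OF closed])
next
  case (7 \<phi> u t)
  have "(\<lambda>x. sat \<NN> (\<lambda>v. E v x) s (BAll u t \<phi>)) =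
      (\<lambda>x. \<forall>y. y \<prec> tm_val (numbers \<MM>) (\<lambda>v. E v x) t \<longrightarrow>
         sat \<NN> (\<lambda>v. env_upd E u v (pr x y)) s \<phi>)"
    using \<open>u \<notin> tm_vars t\<close> by (auto simp: env_upd_pr numbers)
  with Delta0_closedD(5)[OF closed "7.IH"[OF cf_env_upd[OF "7.prems"]] cf_tm_val[OF "7.prems"]]
  show ?case by (simp only:)
next
  case (8 \<phi> u t)
  have "(\<lambda>x. sat \<NN> (\<lambda>v. E v x) s (BEx u t \<phi>)) =
      (\<lambda>x. \<not> (\<forall>y. y \<prec> tm_val (numbers \<MM>) (\<lambda>v. E v x) t \<longrightarrow>
         \<not> sat \<NN> (\<lambda>v. env_upd E u v (pr x y)) s \<phi>))"
    using \<open>u \<notin> tm_vars t\<close> by (auto simp: env_upd_pr numbers)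
  with Delta0_closedD(2)[OF closed Delta0_closedD(5)[OF closed
      Delta0_closedD(2)[OF closed "8.IH"[OF cf_env_upd[OF "8.prems"]]] cf_tm_val[OF "8.prems"]]]
  show ?case by (simp only:)
qed

text \<open>The assignment depends on one number through functions of the model, so a quantified
  value is absorbed by pairing; a Pi formula enters through its negation. The model
  \<open>\<NN>\<close> may be the extension, as only its numbers are fixed.\<close>

lemma sat_Sig:
  "is_Sigma k \<phi> \<Longrightarrow> (\<And>v. cf (E v)) \<Longrightarrow> Sig D k (\<lambda>x. sat \<NN> (\<lambda>v. E v x) s \<phi>)"
  "is_Pi k \<phi> \<Longrightarrow> (\<And>v. cf (E v)) \<Longrightarrow> Sig D k (\<lambda>x. \<not> sat \<NN> (\<lambda>v. E v x) s \<phi>)"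
proof (induction arbitrary: E and E rule: is_Sigma_is_Pi.inducts)
  case (1 \<phi>)
  then show ?case using sat_Delta0 by simp
next
  case (2 n \<phi>)
  from Sig_not[OF closed "2.IH"[OF "2.prems"]] show ?case by simp
next
  case (3 n \<phi> u)
  from Sig_ex[OF closed "3.IH"[of "env_upd E u", OF cf_env_upd[OF "3.prems"]]]
  show ?case by (simp only: env_upd_pr sat.simps)
next
  case (4 \<phi>)
  then show ?case using sat_Delta0 Delta0_closedD(2)[OF closed] by simp
next
  case (5 n \<phi>)
  from Sig_not[OF closed "5.IH"[OF "5.prems"]] show ?case by simp
next
  case (6 n \<phi> u)
  from Sig_ex[OF closed "6.IH"[of "env_upd E u", OF cf_env_upd[OF "6.prems"]]]
  show ?case by (simp only: env_upd_pr sat.simps not_all)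
qed

end

text \<open>This makes the induction scheme available for semantic relations. The argument is an
  arbitrary term because the recursion passes to \<open>tpr t (Var v)\<close>, where
  \<open>v\<close> is fresh by the bound on the variables of \<open>t\<close>. Sigma and Pi forms
  are built together, each quantifier being put before a formula of the other kind. One set
  parameter suffices, for the matrix.\<close>

lemma Sig_formula:
  "Sig dec k P \<Longrightarrow> \<exists>A\<in>sets \<MM>. \<forall>t v. (\<forall>u\<in>tm_vars t. u < v) \<longrightarrow>
     (\<exists>\<phi>. is_Sigma k \<phi> \<and> (\<forall>e s. s 0 = A \<longrightarrow> sat \<MM> e s \<phi> = P (tm_val (numbers \<MM>) e t))) \<and>
     (\<exists>\<phi>. is_Pi k \<phi> \<and> (\<forall>e s. s 0 = A \<longrightarrow> sat \<MM> e s \<phi> = (\<not> P (tm_val (numbers \<MM>) e t))))"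
proof (induction k arbitrary: P)
  case 0
  have "is_Sigma 0 (Mem t 0)" "is_Pi 0 (Neg (Mem t 0))" for t
    by (auto intro!: is_Sigma_is_Pi.intros)
  with 0 show ?case
    by (intro bexI[of _ "{x. P x}"] allI impI conjI exI[of _ "Mem _ 0"] exI[of _ "Neg (Mem _ 0)"])
      (auto simp: dec_def)
next
  case (Suc k)
  then obtain Q where Q: "Sig dec k Q" "P = (\<lambda>x. \<exists>y. \<not> Q (pr x y))" by auto
  from Suc.IH[OF Q(1)] obtain A where A: "A \<in> sets \<MM>"
    and *: "\<And>t v. (\<forall>u\<in>tm_vars t. u < v) \<longrightarrow>
     (\<exists>\<phi>. is_Sigma k \<phi> \<and> (\<forall>e s. s 0 = A \<longrightarrow> sat \<MM> e s \<phi> = Q (tm_val (numbers \<MM>) e t))) \<and>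
     (\<exists>\<phi>. is_Pi k \<phi> \<and> (\<forall>e s. s 0 = A \<longrightarrow> sat \<MM> e s \<phi> = (\<not> Q (tm_val (numbers \<MM>) e t))))"
    by blast
  show ?case
  proof (intro bexI[OF _ A] allI impI)
    fix t and v :: nat
    assume t: "\<forall>u\<in>tm_vars t. u < v"
    then have "\<forall>u\<in>tm_vars (tpr t (Var v)). u < Suc v" by auto
    with *[of "tpr t (Var v)" "Suc v"] obtain \<phi> \<psi> where \<phi>: "is_Sigma k \<phi>" "is_Pi k \<psi>"
      and sat: "\<And>e s. s 0 = A \<Longrightarrow> sat \<MM> e s \<phi> = Q (tm_val (numbers \<MM>) e (tpr t (Var v)))"
        "\<And>e s. s 0 = A \<Longrightarrow> sat \<MM> e s \<psi> = (\<not> Q (tm_val (numbers \<MM>) e (tpr t (Var v))))"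
      by blast
    have v: "v \<notin> tm_vars t" using t by auto
    have "is_Sigma (Suc k) (Ex v \<psi>)" "is_Pi (Suc k) (All v \<phi>)"
      using \<phi> by (auto intro: is_Sigma_is_Pi.intros)
    moreover have "sat \<MM> e s (Ex v \<psi>) = P (tm_val (numbers \<MM>) e t)"
      "sat \<MM> e s (All v \<phi>) = (\<not> P (tm_val (numbers \<MM>) e t))" if "s 0 = A" for e s
      using that v by (simp_all add: sat Q(2))
    ultimately show "(\<exists>\<phi>. is_Sigma (Suc k) \<phi> \<and>
          (\<forall>e s. s 0 = A \<longrightarrow> sat \<MM> e s \<phi> = P (tm_val (numbers \<MM>) e t))) \<and>
        (\<exists>\<phi>. is_Pi (Suc k) \<phi> \<and>
          (\<forall>e s. s 0 = A \<longrightarrow> sat \<MM> e s \<phi> = (\<not> P (tm_val (numbers \<MM>) e t))))"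
      by blast
  qed
qed

lemma Sig_induct:
  assumes "models_ISigma k \<MM>" and "Sig dec k P"
    and "P \<zero>" and step: "\<And>a. P a \<Longrightarrow> P (a \<oplus> \<one>)"
  shows "P a"
proof -
  from Sig_formula[OF assms(2)] obtain A where A: "A \<in> sets \<MM>"
    and *: "\<forall>t v. (\<forall>u\<in>tm_vars t. u < v) \<longrightarrow>
     (\<exists>\<phi>. is_Sigma k \<phi> \<and> (\<forall>e s. s 0 = A \<longrightarrow> sat \<MM> e s \<phi> = P (tm_val (numbers \<MM>) e t))) \<and>
     (\<exists>\<phi>. is_Pi k \<phi> \<and> (\<forall>e s. s 0 = A \<longrightarrow> sat \<MM> e s \<phi> = (\<not> P (tm_val (numbers \<MM>) e t))))"
    by (rule bexE)
  have "\<forall>u\<in>tm_vars (Var 0). u < 1" by simp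
  from conjunct1[OF mp[OF spec[OF spec[OF *]] this]] obtain \<phi> where \<phi>: "is_Sigma k \<phi>"
    and sat: "\<And>e s. s 0 = A \<Longrightarrow> sat \<MM> e s \<phi> = P (tm_val (numbers \<MM>) e (Var 0))"
    by auto
  have "models_induction \<MM> \<phi>" using assms(1) \<phi> by (simp add: models_ISigma_def)
  moreover have "range (\<lambda>_::nat. A) \<subseteq> sets \<MM>" using A by auto
  ultimately have "sat \<MM> (e(0 := \<zero>)) (\<lambda>_. A) \<phi> \<Longrightarrow>
      (\<And>a. sat \<MM> (e(0 := a)) (\<lambda>_. A) \<phi> \<Longrightarrow> sat \<MM> (e(0 := a \<oplus> \<one>)) (\<lambda>_. A) \<phi>) \<Longrightarrow>
      sat \<MM> (e(0 := a)) (\<lambda>_. A) \<phi>" for e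
    unfolding models_induction_def by blast
  then show ?thesis using assms(3) step by (simp add: sat)
qed

lemma ex_induct:
  assumes "dec (\<lambda>z. R (pi1 z) (pi2 z))" and "R \<zero> y0"
    and "\<And>x y. R x y \<Longrightarrow> \<exists>y'. R (x \<oplus> \<one>) y'"
  shows "\<exists>y. R x y"
proof (rule Sig_induct[OF ISigma1])
  have "dec (\<lambda>z. \<not> R (pi1 z) (pi2 z))" by (intro dec_not assms)
  then show "Sig dec 1 (\<lambda>x. \<exists>y. R x y)"
    by (auto intro!: exI[of _ "\<lambda>z. \<not> R (pi1 z) (pi2 z)"])
qed (use assms in auto)

lemma cf_Sig_graph:
  assumes "Sig dec 1 (\<lambda>z. pi2 z = f (pi1 z))"
  shows "cf f"
proof -
  obtain Q where Q: "dec Q" "(\<lambda>z. pi2 z = f (pi1 z)) = (\<lambda>x. \<exists>y. \<not> Q (pr x y))"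
    using assms by auto
  have "(\<exists>w. \<not> Q (pr (pr x y) w)) \<longleftrightarrow> y = f x" for x y
    using fun_cong[OF Q(2), of "pr x y"] by simp
  with Q(1) show ?thesis
    by (intro cf_graph[where \<phi> = "Neg (Mem (tpr (tpr (Var 0) (Var 1)) (Var 2)) 0)"
          and s = "\<lambda>_. {x. Q x}"]) (auto simp: dec_def)
qed

end

section \<open>Coding of finite functions\<close>

context rca_model
begin

section \<open>Divisibility and codes of bounded sets\<close>

lemma dec_le: "cf f \<Longrightarrow> cf g \<Longrightarrow> dec (\<lambda>x. f x \<preceq> g x)"
  unfolding leq_def by (intro dec_disj dec_less dec_eq)

definition divides :: "'a \<Rightarrow> 'a \<Rightarrow> bool" where
  "divides a b \<longleftrightarrow> (\<exists>q. b = a \<otimes> q)"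

lemma divides_times: "divides a (a \<otimes> b)" "divides a (b \<otimes> a)"
  by (auto simp: divides_def times_commute)

lemma divides_timesI: "divides a b \<Longrightarrow> divides a (b \<otimes> c)" "divides a b \<Longrightarrow> divides a (c \<otimes> b)"
  by (auto simp: divides_def times_commute[of c]) (metis times_assoc)+

lemma divides_plus_cancel:
  assumes "divides a (b \<oplus> c)" and "divides a b"
  shows "divides a c"
proof -
  obtain q r where q: "b \<oplus> c = a \<otimes> q" and r: "b = a \<otimes> r" using assms by (auto simp: divides_def)
  have "c = a \<otimes> minusM q r"
    by (metis minusM_plus q r times_minusM)
  then show ?thesis by (auto simp: divides_def)
qed

lemma divides_bounded:
  "divides (\<one> \<oplus> b) m \<longleftrightarrow> (\<exists>q. q \<prec> m \<oplus> \<one> \<and> m = (\<one> \<oplus> b) \<otimes> q)"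
proof -
  have "q \<preceq> (\<one> \<oplus> b) \<otimes> q" for q by (auto simp: le_iff_plus M.distrib_right)
  then show ?thesis unfolding divides_def less_plus_one_iff_le by metis
qed

text \<open>Goedel's coding of finite sets by divisors from a coprime sequence.\<close>

definition modulus :: "'a \<Rightarrow> 'a \<Rightarrow> 'a" where
  "modulus m i = \<one> \<oplus> (i \<oplus> \<one>) \<otimes> m"

definition in_code :: "'a \<Rightarrow> 'a \<Rightarrow> bool" where
  "in_code i c \<longleftrightarrow> divides (modulus (pi1 c) i) (pi2 c)"

lemma dec_in_code:
  assumes "cf f" and "cf g"
  shows "dec (\<lambda>x. in_code (f x) (g x))"
proof -
  have "in_code i c \<longleftrightarrow> (\<exists>q. q \<prec> pi2 c \<oplus> \<one> \<and> pi2 c = (\<one> \<oplus> (i \<oplus> \<one>) \<otimes> pi1 c) \<otimes> q)" for i c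
    by (simp only: in_code_def modulus_def divides_bounded)
  then show ?thesis
    by (simp only:)
      (intro dec_bex dec_prop_intros cf_intros cf_comp[OF assms(1)] cf_comp[OF assms(2)] assms)
qed

text \<open>The common multiple takes the place of the factorial in Goedel's argument. Sigma_1
  induction yields it without any prior coding of sequences.\<close>

lemma common_multiple: "\<exists>m. m \<noteq> \<zero> \<and> (\<forall>i. i \<prec> d \<longrightarrow> divides (i \<oplus> \<one>) m)"
proof -
  let ?R = "\<lambda>d m. m \<noteq> \<zero> \<and> (\<forall>i. i \<prec> d \<longrightarrow> (\<exists>q. q \<prec> m \<oplus> \<one> \<and> m = (\<one> \<oplus> i) \<otimes> q))"
  have bound: "divides (i \<oplus> \<one>) m \<longleftrightarrow> (\<exists>q. q \<prec> m \<oplus> \<one> \<and> m = (\<one> \<oplus> i) \<otimes> q)" for i m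
    by (simp only: plus_commute[of i] divides_bounded)
  have "\<exists>m. ?R d m"
  proof (rule ex_induct[where R = ?R])
    show "dec (\<lambda>z. ?R (pi1 z) (pi2 z))"
      by (intro dec_ball dec_bex dec_prop_intros cf_intros)
    show "?R \<zero> \<one>" by (simp add: not_less_zero)
    fix d m assume m: "?R d m"
    have "m \<otimes> (d \<oplus> \<one>) \<noteq> \<zero>" using m plus_one_neq_zero by simp
    moreover have "divides (i \<oplus> \<one>) (m \<otimes> (d \<oplus> \<one>))" if "i \<prec> d \<oplus> \<one>" for i
    proof (cases "i = d")
      case False
      then have "divides (i \<oplus> \<one>) m" using that m by (simp only: less_plus_one bound) blast
      then show ?thesis by (rule divides_timesI)
    qed (simp add: divides_times)
    ultimately have "?R (d \<oplus> \<one>) (m \<otimes> (d \<oplus> \<one>))" unfolding bound[symmetric] by blast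
    then show "\<exists>m'. ?R (d \<oplus> \<one>) m'" ..
  qed
  then show ?thesis by (simp only: bound)
qed

text \<open>A cancellation without gcds. By the identity \<open>*\<close> the divisor divides
  \<open>n \<otimes> (c \<oplus> \<one>)\<close>, where \<open>c \<oplus> \<one>\<close> is the
  distance of the two indices. This distance divides \<open>m\<close>, so the divisor divides
  \<open>n \<otimes> m\<close>, and \<open>n\<close> is left over when
  \<open>(i \<oplus> \<one>) \<otimes> (n \<otimes> m)\<close> is taken from
  \<open>n \<otimes> modulus m i\<close>.\<close>

lemma modulus_coprime:
  assumes m: "\<And>i. i \<prec> d \<Longrightarrow> divides (i \<oplus> \<one>) m"
    and "i \<prec> d" "k \<prec> d" "i \<noteq> k" and dv: "divides (modulus m i) (n \<otimes> modulus m k)"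
  shows "divides (modulus m i) n"
proof -
  let ?a = "modulus m"
  have *: "(i \<oplus> c \<oplus> \<one> \<oplus> \<one>) \<otimes> ?a i = (i \<oplus> \<one>) \<otimes> ?a (i \<oplus> c \<oplus> \<one>) \<oplus> (c \<oplus> \<one>)" for i c
  proof -
    have "(s \<oplus> r) \<otimes> (\<one> \<oplus> s \<otimes> m) = s \<otimes> (\<one> \<oplus> (s \<oplus> r) \<otimes> m) \<oplus> r" for s r
      by (simp only: semiring_simps M.mult_1_left)
    moreover have "i \<oplus> \<one> \<oplus> (c \<oplus> \<one>) = i \<oplus> c \<oplus> \<one> \<oplus> \<one>"
      by (simp only: M.add.assoc M.add.commute M.add.left_commute)
    ultimately show ?thesis unfolding modulus_def by metis
  qed
  obtain c where c: "c \<prec> d" and dvc: "divides (?a i) (n \<otimes> (c \<oplus> \<one>))"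
  proof (cases "i \<prec> k")
    case True
    then obtain c where k: "k = i \<oplus> c \<oplus> \<one>" by (auto simp: less_iff_plus)
    have "c \<prec> k" using k by (auto simp: less_iff_plus plus_commute)
    moreover have "n \<otimes> ((k \<oplus> \<one>) \<otimes> ?a i) = (i \<oplus> \<one>) \<otimes> (n \<otimes> ?a k) \<oplus> n \<otimes> (c \<oplus> \<one>)"
      unfolding k * by (simp only: distrib_left M.mult.left_commute)
    then have "divides (?a i) (n \<otimes> (c \<oplus> \<one>))"
      using divides_plus_cancel[of "?a i" "(i \<oplus> \<one>) \<otimes> (n \<otimes> ?a k)"]
        divides_timesI(2)[OF dv] divides_timesI(2)[OF divides_times(2)] by metis
    ultimately show ?thesis using that less_trans assms(3) by blast
  next
    case False
    then obtain c where i: "i = k \<oplus> c \<oplus> \<one>"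
      using less_linear[of i k] assms(4) by (auto simp: less_iff_plus)
    have "c \<prec> i" using i by (auto simp: less_iff_plus plus_commute)
    moreover have "(i \<oplus> \<one>) \<otimes> (n \<otimes> ?a k) = n \<otimes> ((k \<oplus> \<one>) \<otimes> ?a i) \<oplus> n \<otimes> (c \<oplus> \<one>)"
      unfolding distrib_left[symmetric] i *[symmetric] by (simp only: M.mult.left_commute)
    then have "divides (?a i) (n \<otimes> (c \<oplus> \<one>))"
      using divides_plus_cancel[of "?a i" "n \<otimes> ((k \<oplus> \<one>) \<otimes> ?a i)"]
        divides_timesI(2)[OF dv] divides_timesI(2)[OF divides_times(2)] by metis
    ultimately show ?thesis using that less_trans assms(2) by blast
  qed
  obtain q where q: "m = (c \<oplus> \<one>) \<otimes> q" using m[OF c] by (auto simp: divides_def)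
  have "n \<otimes> m = n \<otimes> (c \<oplus> \<one>) \<otimes> q" by (simp only: q times_assoc)
  then have "divides (?a i) (n \<otimes> m)" using divides_timesI(1)[OF dvc, of q] by metis
  moreover have "n \<otimes> ?a i = (i \<oplus> \<one>) \<otimes> (n \<otimes> m) \<oplus> n"
    by (simp only: modulus_def semiring_simps M.mult_1_left)
  ultimately show ?thesis
    using divides_plus_cancel[of "?a i" "(i \<oplus> \<one>) \<otimes> (n \<otimes> m)" n]
      divides_timesI(2) divides_times(2)[of "?a i" n] by metis
qed

text \<open>For fixed \<open>m\<close> the code is the product of the moduli of the elements of
  \<open>A\<close> below \<open>e\<close>, built by Sigma_1 induction on \<open>e\<close>.
  Coprimality prevents a new factor from admitting other indices.\<close>

lemma finite_set_code:
  assumes "dec A"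
  shows "\<exists>c. \<forall>i. i \<prec> d \<longrightarrow> (in_code i c \<longleftrightarrow> A i)"
proof -
  obtain m where m: "m \<noteq> \<zero>" "\<And>i. i \<prec> d \<Longrightarrow> divides (i \<oplus> \<one>) m" using common_multiple[of d] by auto
  let ?R = "\<lambda>e n. \<forall>i. i \<prec> d \<longrightarrow> (in_code i (pr m n) \<longleftrightarrow> A i \<and> i \<prec> e)"
  have "\<exists>n. e \<preceq> d \<longrightarrow> ?R e n" for e
  proof (rule ex_induct[where R = "\<lambda>e n. e \<preceq> d \<longrightarrow> ?R e n"])
    show "dec (\<lambda>z. pi1 z \<preceq> d \<longrightarrow> ?R (pi1 z) (pi2 z))"
      by (intro dec_ball dec_in_code dec_prop_intros dec_le cf_intros dec_comp[OF assms])
    \<comment> \<open>As \<open>m\<close> is nonzero, every modulus exceeds one, and the empty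
      product codes the empty set.\<close>
    have "\<not> divides (modulus m i) \<one>" for i
    proof
      assume "divides (modulus m i) \<one>"
      then obtain q where q: "\<one> = modulus m i \<otimes> q" by (auto simp: divides_def)
      then have "q \<noteq> \<zero>" by (auto simp: times_zero)
      then obtain r where r: "q = r \<oplus> \<one>" using zero_or_plus_one by blast
      have "modulus m i \<otimes> q = (modulus m i \<otimes> r \<oplus> (i \<oplus> \<one>) \<otimes> m) \<oplus> \<one>"
        unfolding r times_plus_one plus_assoc by (simp only: modulus_def plus_commute[of \<one>])
      then have "\<zero> \<oplus> \<one> = (modulus m i \<otimes> r \<oplus> (i \<oplus> \<one>) \<otimes> m) \<oplus> \<one>"
        unfolding q[symmetric] by (simp only: zero_plus)
      then have "(i \<oplus> \<one>) \<otimes> m = \<zero>"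
        by (metis plus_one_inject M.add_nonneg_eq_0_iff zero_le)
      then show False using m(1) plus_one_neq_zero by simp
    qed
    then show "\<zero> \<preceq> d \<longrightarrow> ?R \<zero> \<one>" by (simp add: in_code_def not_less_zero)
    fix e n
    assume IH: "e \<preceq> d \<longrightarrow> ?R e n"
    show "\<exists>n'. e \<oplus> \<one> \<preceq> d \<longrightarrow> ?R (e \<oplus> \<one>) n'"
    proof (cases "e \<prec> d")
      case True
      then have n: "?R e n" using IH by (simp add: leq_def)
      show ?thesis
      proof (cases "A e")
        case True
        have "?R (e \<oplus> \<one>) (n \<otimes> modulus m e)"
        proof (intro allI impI)
          fix i assume i: "i \<prec> d"
          show "in_code i (pr m (n \<otimes> modulus m e)) \<longleftrightarrow> A i \<and> i \<prec> e \<oplus> \<one>"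
          proof (cases "i = e")
            case False
            then have "divides (modulus m i) (n \<otimes> modulus m e) \<longleftrightarrow> divides (modulus m i) n"
              using modulus_coprime[OF m(2) i \<open>e \<prec> d\<close>] divides_timesI(1) by blast
            with n i False show ?thesis by (simp add: in_code_def less_plus_one)
          qed (use True in \<open>simp add: in_code_def less_plus_one divides_times\<close>)
        qed
        then show ?thesis by blast
      next
        case False
        with n have "?R (e \<oplus> \<one>) n" by (auto simp: less_plus_one)
        then show ?thesis by blast
      qed
    next
      case False
      then have "\<not> e \<oplus> \<one> \<preceq> d"
        using M.less_le_trans[of e "e \<oplus> \<one>" d] by (auto simp: less_plus_one)
      then show ?thesis by blast
    qed
  qed
  from this[of d] show ?thesis by (auto simp: leq_def)
qed

text \<open>The number \<open>c\<close> codes a finite partial function; \<open>fval c\<close> is junk outside of \<open>fdom c\<close>.\<close>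

definition fdom :: "'a \<Rightarrow> 'a \<Rightarrow> bool" where
  "fdom c i \<longleftrightarrow> i \<prec> pi1 c \<and> in_code i (pi1 (pi2 c))"

definition fval :: "'a \<Rightarrow> 'a \<Rightarrow> bool" where
  "fval c i \<longleftrightarrow> in_code i (pi2 (pi2 c))"

lemma finite_function_code:
  assumes "dec D" and "dec V"
  shows "\<exists>c. (\<forall>i. fdom c i \<longleftrightarrow> i \<prec> d \<and> D i) \<and> (\<forall>i. i \<prec> d \<longrightarrow> (fval c i \<longleftrightarrow> V i))"
proof -
  obtain c1 c2 where "\<And>i. i \<prec> d \<Longrightarrow> in_code i c1 \<longleftrightarrow> D i" "\<And>i. i \<prec> d \<Longrightarrow> in_code i c2 \<longleftrightarrow> V i"
    using finite_set_code[OF assms(1), of d] finite_set_code[OF assms(2), of d] by blast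
  then have "(\<forall>i. fdom (pr d (pr c1 c2)) i \<longleftrightarrow> i \<prec> d \<and> D i) \<and>
      (\<forall>i. i \<prec> d \<longrightarrow> (fval (pr d (pr c1 c2)) i \<longleftrightarrow> V i))"
    by (auto simp: fdom_def fval_def)
  then show ?thesis by (rule exI)
qed

section \<open>Operations on finite partial functions\<close>

lemma dec_fdom: "cf f \<Longrightarrow> cf g \<Longrightarrow> dec (\<lambda>x. fdom (f x) (g x))"
  and dec_fval: "cf f \<Longrightarrow> cf g \<Longrightarrow> dec (\<lambda>x. fval (f x) (g x))"
  unfolding fdom_def fval_def by (intro dec_prop_intros dec_in_code cf_pi1 cf_pi2; assumption)+

lemma finite_function_insert:
  obtains c' where "\<And>i. fdom c' i \<longleftrightarrow> fdom c i \<or> i = z" and "fval c' z \<longleftrightarrow> v"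
    and "\<And>i. fdom c i \<Longrightarrow> i \<noteq> z \<Longrightarrow> fval c' i \<longleftrightarrow> fval c i"
proof -
  have "dec (\<lambda>i. fdom c i \<or> i = z)" "dec (\<lambda>i. if i = z then v else fval c i)"
    unfolding if_bool_eq_conj by (intro dec_prop_intros dec_fdom dec_fval cf_intros)+
  from finite_function_code[OF this, of "pi1 c \<oplus> z \<oplus> \<one>"] obtain c' where c':
    "\<And>i. fdom c' i \<longleftrightarrow> i \<prec> pi1 c \<oplus> z \<oplus> \<one> \<and> (fdom c i \<or> i = z)"
    "\<And>i. i \<prec> pi1 c \<oplus> z \<oplus> \<one> \<Longrightarrow> fval c' i \<longleftrightarrow> (if i = z then v else fval c i)"
    by blast
  have "z \<preceq> pi1 c \<oplus> z" "pi1 c \<preceq> pi1 c \<oplus> z" by (auto simp: le_iff_plus plus_commute)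
  then have "z \<prec> pi1 c \<oplus> z \<oplus> \<one>" "\<And>i. fdom c i \<Longrightarrow> i \<prec> pi1 c \<oplus> z \<oplus> \<one>"
    unfolding fdom_def less_plus_one_iff_le by (auto simp: leq_def intro: less_trans)
  with c' show ?thesis by (intro that[of c']) auto
qed

definition ext :: "'a \<Rightarrow> 'a \<Rightarrow> bool" where
  "ext c d \<longleftrightarrow> (\<forall>i. fdom d i \<longrightarrow> fdom c i \<and> (fval c i \<longleftrightarrow> fval d i))"

lemma ext_refl: "ext c c"
  and ext_trans: "ext c d \<Longrightarrow> ext d e \<Longrightarrow> ext c e"
  by (auto simp: ext_def)

lemma dec_ext:
  assumes "cf f" and "cf g"
  shows "dec (\<lambda>x. ext (f x) (g x))"
proof -
  have "ext c d \<longleftrightarrow> (\<forall>i. i \<prec> pi1 d \<longrightarrow> fdom d i \<longrightarrow> fdom c i \<and> (fval c i \<longleftrightarrow> fval d i))" for c d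
    by (auto simp: ext_def fdom_def)
  then show ?thesis
    by (simp only:) (intro dec_ball dec_prop_intros dec_fdom dec_fval cf_intros
        cf_comp[OF assms(1)] cf_comp[OF assms(2)] assms)
qed

end

section \<open>Forcing\<close>

context rca_model
begin

text \<open>A condition is a single number, read as a right-nested tuple, so that formulas of the
  model can quantify over conditions.\<close>

primrec lev :: "nat \<Rightarrow> 'a \<Rightarrow> 'a" where
  "lev 0 c = pi1 c"
| "lev (Suc j) c = lev j (pi2 c)"

lemma cf_lev: "cf f \<Longrightarrow> cf (\<lambda>x. lev j (f x))"
  by (induction j arbitrary: f) (auto intro: cf_pi1 cf_pi2)

lemma lev_tuple: "\<exists>q. \<forall>j\<le>N. lev j q = f j"
proof (induction N arbitrary: f)
  case 0
  have "lev 0 (pr (f 0) \<zero>) = f 0" by simp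
  then show ?case by blast
next
  case (Suc N)
  obtain q where q: "\<forall>j\<le>N. lev j q = f (Suc j)" using Suc[of "\<lambda>j. f (Suc j)"] by blast
  have "lev j (pr (f 0) q) = f j" if "j \<le> Suc N" for j
    using that q by (cases j) auto
  then show ?case by blast
qed

end

locale columns = rca_model +
  fixes col :: "'a \<Rightarrow> 'a"
  assumes cf_col: "cf col"
begin

text \<open>
  A condition \<open>\<sigma>\<close> consists of finite partial functions \<open>lev j \<sigma>\<close>, approximations to the
  \<open>j\<close>-fold limit of the generic set.  In an extension, a new point of level \<open>j\<close> lying in a column
  already decided by level \<open>j + 1\<close> of the old condition has to take the decided value.
\<close>

definition lock :: "'a \<Rightarrow> 'a \<Rightarrow> 'a \<Rightarrow> bool" where
  "lock c d l \<longleftrightarrow>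
     (\<forall>i. fdom c i \<and> \<not> fdom d i \<and> fdom l (col i) \<longrightarrow> (fval c i \<longleftrightarrow> fval l (col i)))"

definition le :: "nat \<Rightarrow> 'a \<Rightarrow> 'a \<Rightarrow> bool" where
  "le k \<tau> \<sigma> \<longleftrightarrow>
     (\<forall>j<k. ext (lev j \<tau>) (lev j \<sigma>) \<and> lock (lev j \<tau>) (lev j \<sigma>) (lev (Suc j) \<sigma>))"

lemma dec_lock:
  assumes "cf f" and "cf g" and "cf h"
  shows "dec (\<lambda>x. lock (f x) (g x) (h x))"
proof -
  have "lock c d l \<longleftrightarrow> (\<forall>i. i \<prec> pi1 c \<longrightarrow> fdom c i \<and> \<not> fdom d i \<and> fdom l (col i) \<longrightarrow>
      (fval c i \<longleftrightarrow> fval l (col i)))" for c d l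
    by (auto simp: lock_def fdom_def)
  then show ?thesis
    by (simp only:) (intro dec_ball dec_prop_intros dec_fdom dec_fval cf_intros cf_comp[OF cf_col]
        cf_comp[OF assms(1)] cf_comp[OF assms(2)] cf_comp[OF assms(3)] assms)
qed

lemma dec_extends: "cf f \<Longrightarrow> cf g \<Longrightarrow> dec (\<lambda>x. le k (f x) (g x))"
proof (induction k)
  case 0
  then show ?case by (simp add: le_def dec_bool)
next
  case (Suc k)
  have "le (Suc k) \<tau> \<sigma> \<longleftrightarrow> le k \<tau> \<sigma> \<and> ext (lev k \<tau>) (lev k \<sigma>) \<and>
      lock (lev k \<tau>) (lev k \<sigma>) (lev (Suc k) \<sigma>)" for \<tau> \<sigma>
    unfolding le_def by (auto simp: less_Suc_eq)
  moreover have "dec (\<lambda>x. le k (f x) (g x) \<and> ext (lev k (f x)) (lev k (g x)) \<and>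
      lock (lev k (f x)) (lev k (g x)) (lev (Suc k) (g x)))"
    by (intro dec_conj dec_ext dec_lock cf_lev Suc)
  ultimately show ?case by (simp only:)
qed

lemma le_refl: "le k \<sigma> \<sigma>"
  by (auto simp: le_def ext_refl lock_def)

lemma le_mono: "le k \<tau> \<sigma> \<Longrightarrow> j \<le> k \<Longrightarrow> le j \<tau> \<sigma>"
  by (simp add: le_def)

text \<open>\<open>le k \<tau> \<sigma>\<close> says nothing about level \<open>k\<close> of
  \<open>\<tau>\<close>, yet that level locks level \<open>k - 1\<close> of \<open>\<rho>\<close>.
  The third hypothesis guarantees that columns locked by \<open>\<sigma>\<close> stay locked to the
  same values.\<close>

lemma le_trans:
  assumes "le k \<rho> \<tau>" and "le k \<tau> \<sigma>" and "ext (lev k \<tau>) (lev k \<sigma>)"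
  shows "le k \<rho> \<sigma>"
  unfolding le_def
proof (intro allI impI conjI)
  fix j assume j: "j < k"
  have ext: "ext (lev j \<rho>) (lev j \<tau>)" "ext (lev j \<tau>) (lev j \<sigma>)"
    and lock: "lock (lev j \<rho>) (lev j \<tau>) (lev (Suc j) \<tau>)" "lock (lev j \<tau>) (lev j \<sigma>) (lev (Suc j) \<sigma>)"
    using assms j by (simp_all add: le_def del: lev.simps)
  show "ext (lev j \<rho>) (lev j \<sigma>)" using ext by (rule ext_trans)
  have "ext (lev (Suc j) \<tau>) (lev (Suc j) \<sigma>)"
    using assms(2,3) j by (cases "Suc j = k") (auto simp: le_def simp del: lev.simps)
  with ext lock show "lock (lev j \<rho>) (lev j \<sigma>) (lev (Suc j) \<sigma>)"
    unfolding lock_def ext_def by metis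
qed

lemma le_cong:
  assumes "\<And>j. j \<le> k \<Longrightarrow> lev j \<sigma> = lev j \<sigma>'"
  shows "le k \<tau> \<sigma> \<longleftrightarrow> le k \<tau> \<sigma>'"
  using assms by (simp add: le_def del: lev.simps)

text \<open>The actual forcing order. The top level only has to be extended, as there is no level
  above to lock it.\<close>

definition stronger :: "nat \<Rightarrow> 'a \<Rightarrow> 'a \<Rightarrow> bool" where
  "stronger n \<tau> \<sigma> \<longleftrightarrow> le n \<tau> \<sigma> \<and> ext (lev n \<tau>) (lev n \<sigma>)"

lemma stronger_refl: "stronger n \<sigma> \<sigma>"
  by (simp add: stronger_def le_refl ext_refl)

lemma stronger_trans: "stronger n \<rho> \<tau> \<Longrightarrow> stronger n \<tau> \<sigma> \<Longrightarrow> stronger n \<rho> \<sigma>"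
  unfolding stronger_def using le_trans ext_trans by blast

lemma stronger_le: "stronger n \<tau> \<sigma> \<Longrightarrow> k \<le> n \<Longrightarrow> le k \<tau> \<sigma>"
  unfolding stronger_def using le_mono by blast

lemma stronger_ext: "stronger n \<tau> \<sigma> \<Longrightarrow> k \<le> n \<Longrightarrow> ext (lev k \<tau>) (lev k \<sigma>)"
  by (cases "k = n") (auto simp: stronger_def le_def)

lemma le_stronger_trans: "le k \<rho> \<tau> \<Longrightarrow> stronger n \<tau> \<sigma> \<Longrightarrow> k \<le> n \<Longrightarrow> le k \<rho> \<sigma>"
  using le_trans stronger_le stronger_ext by blast

text \<open>\<open>le k\<close> constrains the levels below \<open>k\<close> only, and locks them by
  levels of \<open>\<sigma>\<close>. Hence the lower levels of \<open>\<tau>\<close> together with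
  the upper levels of \<open>\<sigma>\<close> form a genuine stronger condition.\<close>

lemma amalgamate:
  assumes "le k \<tau> \<sigma>" and "k \<le> n"
  obtains \<rho> where "stronger n \<rho> \<sigma>" and "\<And>j. j < k \<Longrightarrow> lev j \<rho> = lev j \<tau>"
    and "\<And>j. k \<le> j \<Longrightarrow> j \<le> n \<Longrightarrow> lev j \<rho> = lev j \<sigma>"
proof -
  obtain \<rho> where \<rho>: "\<forall>j\<le>n. lev j \<rho> = (if j < k then lev j \<tau> else lev j \<sigma>)"
    using lev_tuple[of n "\<lambda>j. if j < k then lev j \<tau> else lev j \<sigma>"] by blast
  then have "ext (lev j \<rho>) (lev j \<sigma>) \<and> lock (lev j \<rho>) (lev j \<sigma>) (lev (Suc j) \<sigma>)" if "j \<le> n" for j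
    using assms that
    by (cases "j < k") (auto simp: le_def ext_refl lock_def simp del: lev.simps)
  then have "stronger n \<rho> \<sigma>" unfolding stronger_def le_def by auto
  with \<rho> assms(2) show ?thesis by (intro that[of \<rho>]) auto
qed

text \<open>
  \<open>FF k A x \<sigma>\<close>: the condition \<open>\<sigma>\<close> forces the \<open>\<Sigma>\<close> statement with \<open>k + 1\<close> alternating
  quantifiers and matrix \<open>A\<close>.  It depends on the levels up to \<open>k\<close> only.
\<close>

primrec FF :: "nat \<Rightarrow> 'a set \<Rightarrow> 'a \<Rightarrow> 'a \<Rightarrow> bool" where
  "FF 0 A x \<sigma> \<longleftrightarrow> (\<exists>u c. ext (lev 0 \<sigma>) c \<and> pr x (pr u c) \<in> A)"
| "FF (Suc k) A x \<sigma> \<longleftrightarrow> (\<exists>y. \<forall>\<tau>. le (Suc k) \<tau> \<sigma> \<longrightarrow> \<not> FF k A (pr x y) \<tau>)"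

text \<open>For positive \<open>k\<close> the definition quantifies over \<open>le k\<close>
  extensions, which are locked by level \<open>k\<close> of the condition. That level has to be
  extended too for \<open>le_trans\<close> to apply; hence \<open>Suc k\<close>.\<close>

lemma FF_mono: "FF k A x \<sigma> \<Longrightarrow> le (Suc k) \<tau> \<sigma> \<Longrightarrow> FF k A x \<tau>"
proof (cases k)
  case 0
  moreover assume "FF k A x \<sigma>" "le (Suc k) \<tau> \<sigma>"
  ultimately show ?thesis by (auto simp: le_def intro: ext_trans)
next
  case (Suc m)
  assume *: "FF k A x \<sigma>" "le (Suc k) \<tau> \<sigma>"
  then have "le k \<tau> \<sigma>" "ext (lev k \<tau>) (lev k \<sigma>)" by (auto simp: le_def simp del: lev.simps)
  with * Suc le_trans[of k _ \<tau> \<sigma>] show ?thesis by (simp del: lev.simps) blast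
qed

lemma FF_cong:
  assumes "\<And>j. j \<le> k \<Longrightarrow> lev j \<sigma> = lev j \<sigma>'"
  shows "FF k A x \<sigma> \<longleftrightarrow> FF k A x \<sigma>'"
proof (cases k)
  case 0
  with assms show ?thesis by simp
next
  case (Suc m)
  with assms le_cong[of k \<sigma> \<sigma>'] show ?thesis by (simp del: lev.simps)
qed

lemma Sig_FF: "A \<in> sets \<MM> \<Longrightarrow> Sig dec (Suc k) (\<lambda>z. FF k A (pi1 z) (pi2 z))"
proof (induction k)
  case 0
  have A: "dec (\<lambda>x. x \<in> A)" using 0 by (simp add: dec_def)
  have "dec (\<lambda>z. \<not> (ext (lev 0 (pi2 (pi1 z))) (pi2 (pi2 z)) \<and>
      pr (pi1 (pi1 z)) (pr (pi1 (pi2 z)) (pi2 (pi2 z))) \<in> A))" (is "dec ?Q")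
    by (intro dec_prop_intros dec_ext dec_comp[OF A] cf_intros cf_lev)
  then have "Sig dec 0 ?Q" by (simp only: Sgm.simps)
  moreover have "FF 0 A (pi1 z) (pi2 z) \<longleftrightarrow> (\<exists>y. \<not> ?Q (pr z y))" for z
    by (simp del: lev.simps) (metis pi1_pr pi2_pr)
  ultimately show ?case by (rule SigI)
next
  case (Suc k)
  let ?R = "\<lambda>w. \<exists>\<tau>. FF k A (pr (pi1 (pi1 w)) (pi2 w)) \<tau> \<and> le (Suc k) \<tau> (pi2 (pi1 w))"
  have "cf (\<lambda>w. pr (pr (pi1 (pi1 (pi1 w))) (pi2 (pi1 w))) (pi2 w))" by (intro cf_intros)
  from Sig_comp[OF Delta0_closed_dec Suc.IH[OF Suc.prems] this]
  have "Sig dec (Suc k) (\<lambda>w. FF k A (pr (pi1 (pi1 (pi1 w))) (pi2 (pi1 w))) (pi2 w))"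
    by (simp del: Sgm.simps)
  moreover have "dec (\<lambda>w. le (Suc k) (pi2 w) (pi2 (pi1 (pi1 w))))"
    by (intro dec_extends cf_intros)
  ultimately have "Sig dec (Suc k) (\<lambda>w. FF k A (pr (pi1 (pi1 (pi1 w))) (pi2 (pi1 w))) (pi2 w) \<and>
      le (Suc k) (pi2 w) (pi2 (pi1 (pi1 w))))"
    by (rule Sig_conj[OF Delta0_closed_dec])
  from Sig_ex[OF Delta0_closed_dec this] have R: "Sig dec (Suc k) ?R" by (simp del: Sgm.simps)
  have "FF (Suc k) A (pi1 z) (pi2 z) \<longleftrightarrow> (\<exists>y. \<not> ?R (pr z y))" for z by auto
  with R show ?case by (rule SigI)
qed

lemma Sig_force:
  assumes "A \<in> sets \<MM>"
  shows "Sig dec (Suc k) (\<lambda>x. \<exists>\<tau>. FF k A x \<tau> \<and> le (Suc k) \<tau> \<sigma>)"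
proof -
  have "dec (\<lambda>z. le (Suc k) (pi2 z) \<sigma>)" by (intro dec_extends cf_intros)
  from Sig_ex[OF Delta0_closed_dec Sig_conj[OF Delta0_closed_dec Sig_FF[OF assms] this]]
  show ?thesis by (simp del: Sgm.simps)
qed

text \<open>Quantifying over \<open>le (Suc k)\<close> instead of the forcing order makes level
  \<open>Suc k\<close> a mere parameter. Where this fails, \<open>dense_FF\<close> turns the
  counterexample into a stronger condition with the same top level, so agreement with
  \<open>W\<close> is preserved.\<close>

definition forces_not :: "nat \<Rightarrow> 'a set \<Rightarrow> 'a \<Rightarrow> 'a \<Rightarrow> bool" where
  "forces_not k A x \<sigma> \<longleftrightarrow> (\<forall>\<tau>. le (Suc k) \<tau> \<sigma> \<longrightarrow> \<not> FF k A x \<tau>)"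

section \<open>Density of the requirements\<close>

lemma dense_FF:
  assumes "FF k A x \<tau>" and "le (Suc k) \<tau> \<sigma>" and "Suc k \<le> n"
  obtains \<rho> where "stronger n \<rho> \<sigma>" and "lev n \<rho> = lev n \<sigma>" and "FF k A x \<rho>"
proof -
  obtain \<rho> where \<rho>: "stronger n \<rho> \<sigma>" "\<And>j. j < Suc k \<Longrightarrow> lev j \<rho> = lev j \<tau>"
    "\<And>j. Suc k \<le> j \<Longrightarrow> j \<le> n \<Longrightarrow> lev j \<rho> = lev j \<sigma>"
    using amalgamate[OF assms(2,3)] by blast
  have "FF k A x \<rho>" using FF_cong[of k \<rho> \<tau>] \<rho>(2) assms(1) by simp
  with \<rho> assms(3) show ?thesis by (intro that[of \<rho>]) auto
qed

lemma dense_decide: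
  assumes "Suc k \<le> n"
  shows "\<exists>\<rho>. stronger n \<rho> \<sigma> \<and> lev n \<rho> = lev n \<sigma> \<and> (FF k A x \<rho> \<or> forces_not k A x \<rho>)"
proof (cases "forces_not k A x \<sigma>")
  case True
  then show ?thesis using stronger_refl by blast
next
  case False
  then show ?thesis unfolding forces_not_def using dense_FF[OF _ _ assms] by metis
qed

lemma dense_induct:
  assumes A: "A \<in> sets \<MM>" and k: "Suc k \<le> n" and ind: "models_ISigma (Suc k) \<MM>"
  shows "\<exists>\<rho>. stronger n \<rho> \<sigma> \<and> lev n \<rho> = lev n \<sigma> \<and>
    (forces_not k A \<zero> \<rho> \<or> FF k A b \<rho> \<or> (\<exists>x. FF k A x \<rho> \<and> forces_not k A (x \<oplus> \<one>) \<rho>))"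
proof -
  let ?H = "\<lambda>x. \<exists>\<tau>. FF k A x \<tau> \<and> le (Suc k) \<tau> \<sigma>"
  \<comment> \<open>Failure of \<open>?H\<close> at \<open>\<sigma>\<close> is inherited by all
    stronger conditions. In the third case it therefore survives the move to a condition that forces
    the statement at \<open>x\<close>.\<close>
  have not_H: "forces_not k A x \<rho>" if "\<not> ?H x" "stronger n \<rho> \<sigma>" for x \<rho>
    using that le_stronger_trans[OF _ _ k] unfolding forces_not_def by blast
  consider "\<not> ?H \<zero>" | "?H b" | x where "?H x" "\<not> ?H (x \<oplus> \<one>)"
    using Sig_induct[OF ind Sig_force[OF A], of \<sigma> b] by blast
  then show ?thesis
  proof cases
    case 1
    then show ?thesis using not_H stronger_refl by blast
  next
    case 2
    then show ?thesis using dense_FF[OF _ _ k] by metis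
  next
    case 3
    then obtain \<rho> where "stronger n \<rho> \<sigma>" "lev n \<rho> = lev n \<sigma>" "FF k A x \<rho>"
      using dense_FF[OF _ _ k] by metis
    then show ?thesis using not_H[OF 3(2)] by blast
  qed
qed

lemma replace_level:
  assumes "j \<le> n" and "ext c (lev j \<sigma>)" and "j < n \<Longrightarrow> lock c (lev j \<sigma>) (lev (Suc j) \<sigma>)"
  obtains \<rho> where "stronger n \<rho> \<sigma>" and "lev j \<rho> = c"
    and "\<And>i. i \<le> n \<Longrightarrow> i \<noteq> j \<Longrightarrow> lev i \<rho> = lev i \<sigma>"
proof -
  obtain \<rho> where \<rho>: "\<forall>i\<le>n. lev i \<rho> = (if i = j then c else lev i \<sigma>)"
    using lev_tuple[of n "\<lambda>i. if i = j then c else lev i \<sigma>"] by blast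
  then have "stronger n \<rho> \<sigma>"
    using assms
    by (auto simp: stronger_def le_def ext_refl simp del: lev.simps) (auto simp: lock_def)
  with \<rho> assms(1) show ?thesis by (intro that[of \<rho>]) auto
qed

lemma dense_dom:
  assumes "j < n"
  shows "\<exists>\<rho>. stronger n \<rho> \<sigma> \<and> lev n \<rho> = lev n \<sigma> \<and> fdom (lev j \<rho>) z"
proof (cases "fdom (lev j \<sigma>) z")
  case True
  then show ?thesis using stronger_refl by blast
next
  case False
  \<comment> \<open>The new point copies the value of its column one level up, as the lock demands.
    For an undecided column this value is junk, but then any value is allowed.\<close>
  obtain c where c: "\<And>i. fdom c i \<longleftrightarrow> fdom (lev j \<sigma>) i \<or> i = z"
    "fval c z \<longleftrightarrow> fval (lev (Suc j) \<sigma>) (col z)"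
    "\<And>i. fdom (lev j \<sigma>) i \<Longrightarrow> i \<noteq> z \<Longrightarrow> fval c i \<longleftrightarrow> fval (lev j \<sigma>) i"
    using finite_function_insert[of "lev j \<sigma>" z] by blast
  have "ext c (lev j \<sigma>)" using c False by (auto simp: ext_def)
  moreover have "lock c (lev j \<sigma>) (lev (Suc j) \<sigma>)" using c by (auto simp: lock_def simp del: lev.simps)
  ultimately obtain \<rho> where "stronger n \<rho> \<sigma>" "lev j \<rho> = c"
    "\<And>i. i \<le> n \<Longrightarrow> i \<noteq> j \<Longrightarrow> lev i \<rho> = lev i \<sigma>"
    using replace_level[of j n c \<sigma>] assms by auto
  with c(1) assms show ?thesis by (intro exI[of _ \<rho>]) auto
qed

definition top_agrees :: "nat \<Rightarrow> 'a set \<Rightarrow> 'a \<Rightarrow> bool" where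
  "top_agrees n W \<sigma> \<longleftrightarrow> (\<forall>i. fdom (lev n \<sigma>) i \<longrightarrow> (fval (lev n \<sigma>) i \<longleftrightarrow> i \<in> W))"

lemma dense_top:
  assumes "top_agrees n W \<sigma>"
  shows "\<exists>\<rho>. stronger n \<rho> \<sigma> \<and> top_agrees n W \<rho> \<and> fdom (lev n \<rho>) z"
proof -
  obtain c where c: "\<And>i. fdom c i \<longleftrightarrow> fdom (lev n \<sigma>) i \<or> i = z"
    "fval c z \<longleftrightarrow> z \<in> W"
    "\<And>i. fdom (lev n \<sigma>) i \<Longrightarrow> i \<noteq> z \<Longrightarrow> fval c i \<longleftrightarrow> fval (lev n \<sigma>) i"
    using finite_function_insert[of "lev n \<sigma>" z] by blast
  have "ext c (lev n \<sigma>)" using c assms by (auto simp: ext_def top_agrees_def)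
  then obtain \<rho> where "stronger n \<rho> \<sigma>" "lev n \<rho> = c"
    using replace_level[of n n c \<sigma>] by auto
  moreover have "fval c i \<longleftrightarrow> i \<in> W" if "fdom c i" for i
    using that c assms by (cases "i = z") (auto simp: top_agrees_def)
  ultimately show ?thesis using c(1) by (intro exI[of _ \<rho>]) (auto simp: top_agrees_def)
qed

end

text \<open>The usual construction of a descending sequence that meets countably many dense sets.
  The invariant \<open>V\<close> will be agreement of the top level with \<open>W\<close>, which
  confines the choice of conditions from outside the model.\<close>

lemma generic_sequence:
  fixes R :: "('a \<Rightarrow> bool) set"
  assumes "countable R" and "V s0"
    and dense: "\<And>r s. r \<in> R \<Longrightarrow> V s \<Longrightarrow> \<exists>t. le t s \<and> V t \<and> r t"
    and refl: "\<And>s. le s s"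
  obtains q :: "nat \<Rightarrow> 'a" where "\<And>i. le (q (Suc i)) (q i)" and "\<And>i. V (q i)"
    and "\<And>r. r \<in> R \<Longrightarrow> \<exists>i. r (q i)"
proof -
  \<comment> \<open>The trivial requirement is added so that the enumerated set is nonempty.\<close>
  let ?r = "from_nat_into (insert (\<lambda>_. True) R)"
  have "\<exists>q. \<forall>i. V (q i) \<and> (le (q (Suc i)) (q i) \<and> ?r i (q (Suc i)))"
  proof (rule dependent_nat_choice)
    show "\<exists>s. V s" using assms(2) by blast
    fix s i assume V: "V s"
    have "?r i \<in> insert (\<lambda>_. True) R" by (rule from_nat_into) simp
    then show "\<exists>t. V t \<and> le t s \<and> ?r i t" using V dense refl by fastforce
  qed
  then obtain q where q: "\<And>i. V (q i)" "\<And>i. le (q (Suc i)) (q i)" "\<And>i. ?r i (q (Suc i))" by blast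
  have "\<exists>i. r (q i)" if "r \<in> R" for r
    using from_nat_into_surj[of "insert (\<lambda>_. True) R" r] assms(1) that q(3) by force
  with q that show ?thesis by blast
qed

section \<open>Generic sets\<close>

text \<open>Exactly the requirements proved dense above: every level becomes total, every Sigma
  statement of the relevant complexity is decided, and induction for it is settled by one of the
  three outcomes.\<close>

locale generic = columns +
  fixes n :: nat and W :: "'a set" and q :: "nat \<Rightarrow> 'a"
  assumes n: "n \<ge> 1"
    and step: "\<And>i. stronger n (q (Suc i)) (q i)"
    and agrees: "\<And>i. top_agrees n W (q i)"
    and total: "\<And>j z. j \<le> n \<Longrightarrow> \<exists>i. fdom (lev j (q i)) z"
    and decides: "\<And>k A x. Suc k \<le> n \<Longrightarrow> A \<in> sets \<MM> \<Longrightarrow>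
      \<exists>i. FF k A x (q i) \<or> forces_not k A x (q i)"
    and inductive_step: "\<And>k A b. Suc k \<le> n \<Longrightarrow> A \<in> sets \<MM> \<Longrightarrow> \<exists>i. forces_not k A \<zero> (q i) \<or>
      FF k A b (q i) \<or> (\<exists>x. FF k A x (q i) \<and> forces_not k A (x \<oplus> \<one>) (q i))"
begin

section \<open>Truth and forcing along the generic sequence\<close>

lemma stronger_mono: "i \<le> j \<Longrightarrow> stronger n (q j) (q i)"
  by (induction rule: dec_induct) (auto intro: stronger_refl stronger_trans step)

text \<open>\<open>PP k A\<close> is the \<open>\<Sigma>\<close> relation that \<open>FF k A\<close> forces, evaluated at the generic set.\<close>

definition PP :: "nat \<Rightarrow> 'a set \<Rightarrow> 'a \<Rightarrow> bool" where
  "PP k A x \<longleftrightarrow> (\<exists>i. FF k A x (q i))"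

text \<open>The truth lemma for negations. Any two members of the sequence have a common extension
  in it, so they cannot force opposite statements, and some member decides.\<close>

lemma forces_not_iff:
  assumes "Suc k \<le> n" and "A \<in> sets \<MM>"
  shows "(\<exists>i. forces_not k A x (q i)) \<longleftrightarrow> \<not> PP k A x"
proof
  assume "\<exists>i. forces_not k A x (q i)"
  then obtain i where i: "forces_not k A x (q i)" ..
  show "\<not> PP k A x"
  proof
    assume "PP k A x"
    then obtain j where "FF k A x (q j)" by (auto simp: PP_def)
    then have "FF k A x (q (max i j))"
      using FF_mono stronger_le[OF stronger_mono assms(1)] by (meson max.cobounded2)
    moreover have "le (Suc k) (q (max i j)) (q i)"
      using stronger_le[OF stronger_mono assms(1)] by simp
    ultimately show False using i by (auto simp: forces_not_def simp del: FF.simps)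
  qed
next
  show "\<not> PP k A x \<Longrightarrow> \<exists>i. forces_not k A x (q i)"
    using decides[OF assms, of x] by (auto simp: PP_def simp del: FF.simps)
qed

lemma PP_Suc:
  assumes "Suc k \<le> n" and "A \<in> sets \<MM>"
  shows "PP (Suc k) A x \<longleftrightarrow> (\<exists>y. \<not> PP k A (pr x y))"
  unfolding forces_not_iff[OF assms, symmetric] by (auto simp: PP_def forces_not_def)

text \<open>Of the three outcomes in \<open>inductive_step\<close>, the first contradicts the base
  case and the third contradicts the induction step.\<close>

lemma PP_induct:
  assumes "Suc k \<le> n" and "A \<in> sets \<MM>"
    and "PP k A \<zero>" and "\<And>x. PP k A x \<Longrightarrow> PP k A (x \<oplus> \<one>)"
  shows "PP k A b"
  using inductive_step[OF assms(1,2), of b] forces_not_iff[OF assms(1,2)] assms(3,4)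
  by (metis PP_def)

text \<open>\<open>G j\<close> is the \<open>j\<close>-fold limit of the generic set \<open>G 0\<close>.\<close>

definition G :: "nat \<Rightarrow> 'a set" where
  "G j = {z. \<exists>i. fdom (lev j (q i)) z \<and> fval (lev j (q i)) z}"

section \<open>Limits of the generic set\<close>

lemma G_iff:
  assumes "j \<le> n" and "fdom (lev j (q i)) z"
  shows "z \<in> G j \<longleftrightarrow> fval (lev j (q i)) z"
proof
  assume "z \<in> G j"
  then obtain i' where i': "fdom (lev j (q i')) z" "fval (lev j (q i')) z" by (auto simp: G_def)
  have "ext (lev j (q (max i i'))) (lev j (q i))" "ext (lev j (q (max i i'))) (lev j (q i'))"
    using stronger_ext[OF stronger_mono assms(1)] by simp_all
  with i' assms(2) show "fval (lev j (q i)) z" by (auto simp: ext_def simp del: lev.simps)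
qed (use assms in \<open>auto simp: G_def\<close>)

lemma G_top: "G n = W"
proof -
  have "z \<in> G n \<longleftrightarrow> z \<in> W" for z
  proof -
    obtain i where i: "fdom (lev n (q i)) z" using total by blast
    then show ?thesis using agrees[of i] G_iff[OF order_refl i] by (simp add: top_agrees_def)
  qed
  then show ?thesis by blast
qed

text \<open>Once level \<open>j + 1\<close> has decided \<open>i\<close> at stage \<open>t\<close>,
  every later point of column \<open>i\<close> on level \<open>j\<close> must copy that value. The
  points already present at stage \<open>t\<close> lie below a bound, and by \<open>rows\<close> the
  column eventually stays beyond it.\<close>

lemma G_limit:
  assumes j: "j < n" and inv: "\<And>m. col (p i m) = i"
    and rows: "\<And>d. \<exists>u. \<forall>m. u \<preceq> m \<longrightarrow> \<not> p i m \<prec> d"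
  shows "\<exists>u. \<forall>m. u \<preceq> m \<longrightarrow> (p i m \<in> G j \<longleftrightarrow> i \<in> G (Suc j))"
proof -
  obtain t where t: "fdom (lev (Suc j) (q t)) i" using total[of "Suc j" i] j by auto
  obtain u where u: "\<forall>m. u \<preceq> m \<longrightarrow> \<not> p i m \<prec> pi1 (lev j (q t))" using rows by blast
  have "p i m \<in> G j \<longleftrightarrow> i \<in> G (Suc j)" if "u \<preceq> m" for m
  proof -
    have new: "\<not> fdom (lev j (q t)) (p i m)" using u that by (auto simp: fdom_def)
    obtain t' where t': "fdom (lev j (q t')) (p i m)" using total[of j "p i m"] j by auto
    define r where "r = max t t'"
    have r: "ext (lev j (q r)) (lev j (q t'))" "stronger n (q r) (q t)"
      using stronger_ext[OF stronger_mono, of t' r j] stronger_mono[of t r] j by (auto simp: r_def)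
    have dom: "fdom (lev j (q r)) (p i m)" using r(1) t' by (auto simp: ext_def)
    have "lock (lev j (q r)) (lev j (q t)) (lev (Suc j) (q t))"
      using r(2) j unfolding stronger_def le_def by blast
    with dom new t inv have "fval (lev j (q r)) (p i m) \<longleftrightarrow> fval (lev (Suc j) (q t)) i"
      unfolding lock_def by metis
    then show ?thesis using G_iff[OF _ dom] G_iff[OF _ t] j by simp
  qed
  then show ?thesis by blast
qed

text \<open>Coded finite parts of the characteristic function of \<open>G 0\<close> that are
  contained in a condition of the sequence.\<close>

definition initial :: "'a \<Rightarrow> bool" where
  "initial c \<longleftrightarrow> (\<exists>i. ext (lev 0 (q i)) c)"

lemma initial_ex: "\<exists>c. initial c"
  using ext_refl initial_def by blast

lemma initial_directed: "initial c \<Longrightarrow> initial d \<Longrightarrow> \<exists>e. initial e \<and> ext e c \<and> ext e d"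
proof -
  assume "initial c" "initial d"
  then obtain i j where "ext (lev 0 (q i)) c" "ext (lev 0 (q j)) d" unfolding initial_def by blast
  moreover have "ext (lev 0 (q (max i j))) (lev 0 (q i))" "ext (lev 0 (q (max i j))) (lev 0 (q j))"
    using stronger_ext[OF stronger_mono, of _ "max i j" 0] by simp_all
  ultimately show ?thesis unfolding initial_def using ext_refl ext_trans by blast
qed

section \<open>Relations that are Sigma_1 in the generic set\<close>

lemma PP_0: "PP 0 A x \<longleftrightarrow> (\<exists>u c. initial c \<and> pr x (pr u c) \<in> A)"
  by (auto simp: PP_def initial_def)

text \<open>The relations \<open>\<Sigma>\<^sub>1\<close> in the generic set and a set of \<open>\<MM>\<close>.\<close>

definition S1 :: "('a \<Rightarrow> bool) \<Rightarrow> bool" where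
  "S1 P \<longleftrightarrow> (\<exists>A\<in>sets \<MM>. P = PP 0 A)"

definition dec3 :: "('a \<Rightarrow> 'a \<Rightarrow> 'a \<Rightarrow> bool) \<Rightarrow> bool" where
  "dec3 R \<longleftrightarrow> dec (\<lambda>z. R (pi1 z) (pi1 (pi2 z)) (pi2 (pi2 z)))"

lemma dec3_comp:
  assumes "dec3 R" and "cf f" and "cf g" and "cf h"
  shows "dec (\<lambda>x. R (f x) (g x) (h x))"
proof -
  have "cf (\<lambda>x. pr (f x) (pr (g x) (h x)))" by (intro cf_intros assms)
  from dec_comp[OF assms(1)[unfolded dec3_def] this] show ?thesis by simp
qed

lemma S1I:
  assumes "dec3 R" and "\<And>x. P x \<longleftrightarrow> (\<exists>u c. initial c \<and> R x u c)"
  shows "S1 P"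
proof -
  let ?A = "{z. R (pi1 z) (pi1 (pi2 z)) (pi2 (pi2 z))}"
  have "?A \<in> sets \<MM>" using assms(1) by (simp add: dec3_def dec_def)
  moreover have "P = PP 0 ?A" by (rule ext) (simp add: PP_0 assms(2))
  ultimately show ?thesis unfolding S1_def by blast
qed

text \<open>A monotone normal form: the witnesses become bounded by \<open>u\<close>, and the finite
  part \<open>c\<close> may be enlarged. So several instances can share one bound and one finite
  part.\<close>

lemma S1E:
  assumes "S1 P"
  shows "\<exists>R. dec3 R \<and> (\<forall>x. P x \<longleftrightarrow> (\<exists>u c. initial c \<and> R x u c)) \<and>
    (\<forall>x u c u' c'. R x u c \<longrightarrow> u \<preceq> u' \<longrightarrow> ext c' c \<longrightarrow> R x u' c')"
proof -
  obtain A where A: "A \<in> sets \<MM>" "P = PP 0 A" using assms unfolding S1_def by blast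
  have dA: "dec (\<lambda>x. x \<in> A)" using A by (simp add: dec_def)
  let ?R = "\<lambda>x u c. \<exists>v. v \<prec> u \<and> (\<exists>d. d \<prec> u \<and> ext c d \<and> pr x (pr v d) \<in> A)"
  have "dec3 ?R"
    unfolding dec3_def by (intro dec_bex dec_conj dec_comp[OF dA] dec_ext cf_intros)
  moreover have "P x \<longleftrightarrow> (\<exists>u c. initial c \<and> ?R x u c)" for x
  proof
    assume "P x"
    then obtain v d where *: "initial d" "pr x (pr v d) \<in> A" by (auto simp: A PP_0)
    have "v \<prec> v \<oplus> d \<oplus> \<one>" "d \<prec> v \<oplus> d \<oplus> \<one>"
      by (simp_all only: less_plus_one_iff_le le_plus)
    with * ext_refl show "\<exists>u c. initial c \<and> ?R x u c" by blast
  next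
    assume "\<exists>u c. initial c \<and> ?R x u c"
    then obtain c v d where "initial c" "ext c d" "pr x (pr v d) \<in> A" by blast
    moreover have "initial d" using \<open>initial c\<close> \<open>ext c d\<close> ext_trans unfolding initial_def by blast
    ultimately show "P x" by (auto simp: A PP_0)
  qed
  moreover have "?R x u' c'" if "?R x u c" "u \<preceq> u'" "ext c' c" for x u c u' c'
    using that M.less_le_trans ext_trans by meson
  ultimately show ?thesis by (intro exI[of _ ?R] conjI allI impI) blast+
qed

lemma S1_dec: "dec P \<Longrightarrow> S1 P"
  by (rule S1I[of "\<lambda>x u c. P x"]) (auto simp: dec3_def initial_ex intro: dec_comp cf_pi)

lemma S1_comp:
  assumes "S1 P" and "cf f"
  shows "S1 (\<lambda>x. P (f x))"
proof -
  obtain R where R: "dec3 R" "\<forall>x. P x \<longleftrightarrow> (\<exists>u c. initial c \<and> R x u c)"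
    "\<forall>x u c u' c'. R x u c \<longrightarrow> u \<preceq> u' \<longrightarrow> ext c' c \<longrightarrow> R x u' c'" using S1E[OF assms(1)] by (elim exE conjE)
  have "dec3 (\<lambda>x. R (f x))"
    unfolding dec3_def by (intro dec3_comp[OF R(1)] cf_intros cf_comp[OF assms(2)])
  then show ?thesis by (rule S1I) (simp add: R(2))
qed

lemma S1_ex:
  assumes "S1 P"
  shows "S1 (\<lambda>x. \<exists>y. P (pr x y))"
proof -
  obtain R where R: "dec3 R" "\<forall>x. P x \<longleftrightarrow> (\<exists>u c. initial c \<and> R x u c)"
    "\<forall>x u c u' c'. R x u c \<longrightarrow> u \<preceq> u' \<longrightarrow> ext c' c \<longrightarrow> R x u' c'" using S1E[OF assms] by (elim exE conjE)
  show ?thesis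
  proof (rule S1I)
    show "dec3 (\<lambda>x u c. R (pr x (pi1 u)) (pi2 u) c)"
      unfolding dec3_def by (intro dec3_comp[OF R(1)] cf_intros)
    show "(\<exists>y. P (pr x y)) \<longleftrightarrow> (\<exists>u c. initial c \<and> R (pr x (pi1 u)) (pi2 u) c)" for x
      using R(2) by (metis pi1_pr pi2_pr)
  qed
qed

lemma S1_conj:
  assumes "S1 P" and "S1 Q"
  shows "S1 (\<lambda>x. P x \<and> Q x)"
proof -
  obtain R where R: "dec3 R" "\<forall>x. P x \<longleftrightarrow> (\<exists>u c. initial c \<and> R x u c)"
    "\<forall>x u c u' c'. R x u c \<longrightarrow> u \<preceq> u' \<longrightarrow> ext c' c \<longrightarrow> R x u' c'" using S1E[OF assms(1)] by (elim exE conjE)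
  obtain T where T: "dec3 T" "\<forall>x. Q x \<longleftrightarrow> (\<exists>u c. initial c \<and> T x u c)"
    "\<forall>x u c u' c'. T x u c \<longrightarrow> u \<preceq> u' \<longrightarrow> ext c' c \<longrightarrow> T x u' c'" using S1E[OF assms(2)] by (elim exE conjE)
  show ?thesis
  proof (rule S1I)
    show "dec3 (\<lambda>x u c. R x u c \<and> T x u c)"
      using R(1) T(1) unfolding dec3_def by (rule dec_conj)
    show "P x \<and> Q x \<longleftrightarrow> (\<exists>u c. initial c \<and> R x u c \<and> T x u c)" for x
    proof
      assume "P x \<and> Q x"
      then obtain u c v d where *: "initial c" "R x u c" "initial d" "T x v d" using R(2) T(2) by blast
      then obtain e where "initial e" "ext e c" "ext e d" using initial_directed by blast
      moreover have "u \<preceq> u \<oplus> v" "v \<preceq> u \<oplus> v" by (rule le_plus)+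
      ultimately show "\<exists>u c. initial c \<and> R x u c \<and> T x u c" using * R(3) T(3) by blast
    qed (use R(2) T(2) in blast)
  qed
qed

lemma S1_disj:
  assumes "S1 P" and "S1 Q"
  shows "S1 (\<lambda>x. P x \<or> Q x)"
proof -
  obtain R where R: "dec3 R" "\<forall>x. P x \<longleftrightarrow> (\<exists>u c. initial c \<and> R x u c)"
    "\<forall>x u c u' c'. R x u c \<longrightarrow> u \<preceq> u' \<longrightarrow> ext c' c \<longrightarrow> R x u' c'" using S1E[OF assms(1)] by (elim exE conjE)
  obtain T where T: "dec3 T" "\<forall>x. Q x \<longleftrightarrow> (\<exists>u c. initial c \<and> T x u c)"
    "\<forall>x u c u' c'. T x u c \<longrightarrow> u \<preceq> u' \<longrightarrow> ext c' c \<longrightarrow> T x u' c'" using S1E[OF assms(2)] by (elim exE conjE)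
  have "dec3 (\<lambda>x u c. R x u c \<or> T x u c)"
    using R(1) T(1) unfolding dec3_def by (rule dec_disj)
  then show ?thesis by (rule S1I) (use R(2) T(2) in blast)
qed

lemma S1_induct:
  assumes "S1 P" and "P \<zero>" and "\<And>x. P x \<Longrightarrow> P (x \<oplus> \<one>)"
  shows "P b"
  using assms PP_induct[of 0] n unfolding S1_def by auto

text \<open>Sigma_1 collection relative to \<open>G 0\<close>. By \<open>S1_induct\<close> on
  \<open>d\<close> there are one bound and one finite part that serve all \<open>y\<close> below
  \<open>d\<close>; the successor step joins them with the data for \<open>d\<close> itself.\<close>

lemma S1_ball:
  assumes "S1 P" and "cf b"
  shows "S1 (\<lambda>x. \<forall>y. y \<prec> b x \<longrightarrow> P (pr x y))"
proof -
  obtain R where R: "dec3 R" "\<forall>x. P x \<longleftrightarrow> (\<exists>u c. initial c \<and> R x u c)"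
    "\<forall>x u c u' c'. R x u c \<longrightarrow> u \<preceq> u' \<longrightarrow> ext c' c \<longrightarrow> R x u' c'" using S1E[OF assms(1)] by (elim exE conjE)
  show ?thesis
  proof (rule S1I)
    show "dec3 (\<lambda>x u c. \<forall>y. y \<prec> b x \<longrightarrow> R (pr x y) u c)"
      unfolding dec3_def by (intro dec_ball dec3_comp[OF R(1)] cf_intros cf_comp[OF assms(2)])
    fix x
    have "\<exists>u c. initial c \<and> (\<forall>y. y \<prec> d \<longrightarrow> y \<prec> b x \<longrightarrow> R (pr x y) u c)"
      if P: "\<And>y. y \<prec> b x \<Longrightarrow> P (pr x y)" for d
    proof (rule S1_induct[where P = "\<lambda>d. \<exists>u c. initial c \<and> (\<forall>y. y \<prec> d \<longrightarrow> y \<prec> b x \<longrightarrow> R (pr x y) u c)"])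
      show "S1 (\<lambda>d. \<exists>u c. initial c \<and> (\<forall>y. y \<prec> d \<longrightarrow> y \<prec> b x \<longrightarrow> R (pr x y) u c))"
      proof (rule S1I)
        show "dec3 (\<lambda>d u c. \<forall>y. y \<prec> d \<longrightarrow> y \<prec> b x \<longrightarrow> R (pr x y) u c)"
          unfolding dec3_def by (intro dec_ball dec_imp dec_less dec3_comp[OF R(1)] cf_intros)
      qed (rule refl)
      show "\<exists>u c. initial c \<and> (\<forall>y. y \<prec> \<zero> \<longrightarrow> y \<prec> b x \<longrightarrow> R (pr x y) u c)"
        using initial_ex not_less_zero by blast
      fix d assume "\<exists>u c. initial c \<and> (\<forall>y. y \<prec> d \<longrightarrow> y \<prec> b x \<longrightarrow> R (pr x y) u c)"
      then obtain u c where uc: "initial c" "\<And>y. y \<prec> d \<Longrightarrow> y \<prec> b x \<Longrightarrow> R (pr x y) u c" by blast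
      show "\<exists>u c. initial c \<and> (\<forall>y. y \<prec> d \<oplus> \<one> \<longrightarrow> y \<prec> b x \<longrightarrow> R (pr x y) u c)"
      proof (cases "d \<prec> b x")
        case True
        then obtain v c' where v: "initial c'" "R (pr x d) v c'" using P R(2) by blast
        then obtain e where e: "initial e" "ext e c" "ext e c'" using uc(1) initial_directed by blast
        have "u \<preceq> u \<oplus> v" "v \<preceq> u \<oplus> v" by (rule le_plus)+
        then have "R (pr x y) (u \<oplus> v) e" if "y \<prec> d \<oplus> \<one>" "y \<prec> b x" for y
          using that uc(2) v(2) e R(3) unfolding less_plus_one by blast
        with e(1) show ?thesis by blast
      next
        case False
        with uc show ?thesis by (auto simp: less_plus_one)
      qed
    qed
    from this[of "b x"] show "(\<forall>y. y \<prec> b x \<longrightarrow> P (pr x y)) \<longleftrightarrow>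
        (\<exists>u c. initial c \<and> (\<forall>y. y \<prec> b x \<longrightarrow> R (pr x y) u c))"
      using R(2) by blast
  qed
qed

section \<open>The model generated by the generic set\<close>

definition D1 :: "('a \<Rightarrow> bool) \<Rightarrow> bool" where
  "D1 P \<longleftrightarrow> S1 P \<and> S1 (\<lambda>x. \<not> P x)"

lemma Delta0_closed_D1: "Delta0_closed D1"
  unfolding Delta0_closed_def
proof (intro conjI allI impI)
  show "dec P \<Longrightarrow> D1 P" for P by (simp add: D1_def S1_dec dec_not)
  show "D1 P \<Longrightarrow> D1 (\<lambda>x. \<not> P x)" for P by (simp add: D1_def)
  show "D1 P \<Longrightarrow> D1 Q \<Longrightarrow> D1 (\<lambda>x. P x \<and> Q x)" for P Q
    using S1_conj[of P Q] S1_disj[of "\<lambda>x. \<not> P x" "\<lambda>x. \<not> Q x"] by (simp add: D1_def)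
  show "D1 P \<Longrightarrow> cf f \<Longrightarrow> D1 (\<lambda>x. P (f x))" for P f
    using S1_comp[of P f] S1_comp[of "\<lambda>x. \<not> P x" f] by (simp add: D1_def)
  show "D1 (\<lambda>x. \<forall>y. y \<prec> b x \<longrightarrow> P (pr x y))" if "D1 P" "cf b" for P b
  proof -
    have "dec (\<lambda>z. pi2 z \<prec> b (pi1 z))" by (intro dec_less cf_pi cf_comp[OF that(2)])
    from S1_ex[OF S1_conj[OF S1_dec[OF this]], of "\<lambda>z. \<not> P z"] that
    show ?thesis using S1_ball[of P b] by (simp add: D1_def)
  qed
qed

definition extension :: "'a so_model" where
  "extension = \<lparr>numbers = numbers \<MM>, sets = {B. D1 (\<lambda>x. x \<in> B)}\<rparr>"

lemma numbers_extension [simp]: "numbers extension = numbers \<MM>"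
  by (simp add: extension_def)

lemma in_sets_extension: "{x. P x} \<in> sets extension \<longleftrightarrow> D1 P"
  by (simp add: extension_def)

lemma omega_submodel_extension: "omega_submodel \<MM> extension"
  using Delta0_closedD(1)[OF Delta0_closed_D1] by (auto simp: omega_submodel_def extension_def dec_def)

lemma sat_extension:
  assumes "range s \<subseteq> sets extension"
  shows "is_Sigma k \<phi> \<Longrightarrow> Sig D1 k (\<lambda>a. sat extension (e(x := a)) s \<phi>)"
    and "is_Pi k \<phi> \<Longrightarrow> Sig D1 k (\<lambda>a. \<not> sat extension (e(x := a)) s \<phi>)"
proof -
  define E where "E = (\<lambda>v. if v = x then (\<lambda>a. a) else (\<lambda>_. e v))"
  have cf: "\<And>v. cf (E v)" by (simp add: E_def cf_id cf_const)
  have env: "(\<lambda>v. E v a) = e(x := a)" for a by (auto simp: E_def)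
  have s: "D1 (\<lambda>y. y \<in> s X)" for X using assms by (auto simp: extension_def)
  show "is_Sigma k \<phi> \<Longrightarrow> Sig D1 k (\<lambda>a. sat extension (e(x := a)) s \<phi>)"
    using sat_Sig(1)[where s = s and E = E, OF Delta0_closed_D1 numbers_extension s _ cf] by (simp only: env)
  show "is_Pi k \<phi> \<Longrightarrow> Sig D1 k (\<lambda>a. \<not> sat extension (e(x := a)) s \<phi>)"
    using sat_Sig(2)[where s = s and E = E, OF Delta0_closed_D1 numbers_extension s _ cf] by (simp only: env)
qed

lemma Sig_D1_S1: "Sig D1 1 P \<Longrightarrow> S1 P"
  using S1_ex by (auto simp: D1_def)

text \<open>A Sigma_1 relation over \<open>D1\<close> is Sigma_1 in \<open>G 0\<close> and a set of
  \<open>\<MM>\<close>. Above this level \<open>PP_Suc\<close> matches the recursion of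
  \<open>Sgm\<close>, as long as the statements in question are decided by the sequence.\<close>

lemma Sig_D1: "Sig D1 (Suc k) P \<Longrightarrow> Suc k \<le> n \<Longrightarrow> \<exists>A\<in>sets \<MM>. P = PP k A"
proof (induction k arbitrary: P)
  case 0
  then show ?case using Sig_D1_S1 by (simp add: S1_def)
next
  case (Suc k)
  then obtain Q where Q: "Sig D1 (Suc k) Q" "P = (\<lambda>x. \<exists>y. \<not> Q (pr x y))"
    by (auto simp del: Sgm.simps simp: Sgm.simps(2)[of _ _ "Suc k"])
  with Suc obtain A where A: "A \<in> sets \<MM>" "Q = PP k A" by auto
  have "P = PP (Suc k) A" using Suc.prems(2) by (simp add: fun_eq_iff Q(2) A PP_Suc)
  with A(1) show ?case by blast
qed

lemma ISigma_extension: "Suc k \<le> n \<Longrightarrow> models_ISigma (Suc k) extension"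
  unfolding models_ISigma_def models_induction_def numbers_extension
proof (intro allI impI)
  fix \<phi> x e a and s :: "nat \<Rightarrow> 'a set"
  assume k: "Suc k \<le> n" and \<phi>: "is_Sigma (Suc k) \<phi>" and s: "range s \<subseteq> sets extension"
    and zero: "sat extension (e(x := \<zero>)) s \<phi>"
    and succ: "\<forall>a. sat extension (e(x := a)) s \<phi> \<longrightarrow> sat extension (e(x := a \<oplus> \<one>)) s \<phi>"
  obtain A where A: "A \<in> sets \<MM>" "(\<lambda>a. sat extension (e(x := a)) s \<phi>) = PP k A"
    using Sig_D1[OF sat_extension(1)[OF s \<phi>] k] by blast
  have "sat extension (e(x := a)) s \<phi> \<longleftrightarrow> PP k A a" for a using fun_cong[OF A(2)] by simp
  with zero succ PP_induct[OF k A(1)] show "sat extension (e(x := a)) s \<phi>" by simp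
qed

lemma Delta1_CA_extension: "models_Delta1_CA extension"
  unfolding models_Delta1_CA_def
proof (intro allI impI)
  fix \<phi> \<psi> x e and s :: "nat \<Rightarrow> 'a set"
  assume \<phi>: "is_Sigma 1 \<phi>" and \<psi>: "is_Pi 1 \<psi>" and s: "range s \<subseteq> sets extension"
    and eq: "\<forall>a. sat extension (e(x := a)) s \<phi> = sat extension (e(x := a)) s \<psi>"
  have "S1 (\<lambda>a. sat extension (e(x := a)) s \<phi>)" "S1 (\<lambda>a. \<not> sat extension (e(x := a)) s \<psi>)"
    using Sig_D1_S1 sat_extension[OF s] \<phi> \<psi> by blast+
  with eq show "{a. sat extension (e(x := a)) s \<phi>} \<in> sets extension"
    by (simp add: in_sets_extension D1_def)
qed

lemma RCA0_extension: "models_RCA0 extension"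
  using basic ISigma_extension[of 0] Delta1_CA_extension n by (simp add: models_RCA0_def)

text \<open>Every point is eventually decided, so non-membership, like membership, is witnessed by a
  finite part.\<close>

lemma G_in_extension: "G 0 \<in> sets extension"
proof -
  have dom: "\<exists>i. fdom (lev 0 (q i)) x" for x using total by blast
  have in_G: "x \<in> G 0 \<longleftrightarrow> fval c x" if "initial c" "fdom c x" for c x
    using that G_iff[of 0 _ x] unfolding initial_def ext_def by (metis le0)
  have iff: "x \<in> G 0 \<longleftrightarrow> (\<exists>u c. initial c \<and> fdom c x \<and> fval c x)"
    "x \<notin> G 0 \<longleftrightarrow> (\<exists>u c. initial c \<and> fdom c x \<and> \<not> fval c x)" for x
    using in_G dom[of x] ext_refl unfolding initial_def by blast+
  have "dec3 (\<lambda>x u c. fdom c x \<and> fval c x)" "dec3 (\<lambda>x u c. fdom c x \<and> \<not> fval c x)"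
    unfolding dec3_def by (intro dec_prop_intros dec_fdom dec_fval cf_intros)+
  from this[THEN S1I] iff have "D1 (\<lambda>x. x \<in> G 0)" unfolding D1_def by simp
  then show ?thesis by (simp add: extension_def)
qed

end

section \<open>Existence of a generic sequence\<close>

lemma is_Sigma_Suc: "is_Sigma k \<phi> \<Longrightarrow> is_Sigma (Suc k) \<phi>"
  and is_Pi_Suc: "is_Pi k \<phi> \<Longrightarrow> is_Pi (Suc k) \<phi>"
  by (induction rule: is_Sigma_is_Pi.inducts) (auto intro: is_Sigma_is_Pi.intros)

lemma models_ISigma_mono:
  assumes "models_ISigma n \<MM>" and "k \<le> n"
  shows "models_ISigma k \<MM>"
proof -
  have "is_Sigma k \<phi> \<Longrightarrow> is_Sigma n \<phi>" for \<phi>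
    using assms(2) by (induction rule: dec_induct) (auto intro: is_Sigma_Suc)
  with assms(1) show ?thesis by (auto simp: models_ISigma_def)
qed

text \<open>There are countably many requirements because numbers and sets of the model are
  countable. Only totality of the top level changes that level, and there the values are taken from
  \<open>W\<close>.\<close>

lemma (in columns) generic_exists:
  assumes "countable (UNIV :: 'a set)" and "countable (sets \<MM>)"
    and n: "n \<ge> 1" and ind: "models_ISigma n \<MM>"
  obtains q where "generic \<MM> col n W q"
proof -
  define Rdom where "Rdom = (\<lambda>(j, z). \<lambda>s. fdom (lev j s) z) ` ({..n} \<times> UNIV)"
  define Rdec where "Rdec = (\<lambda>(k, A, x). \<lambda>s. FF k A x s \<or> forces_not k A x s) ` ({..<n} \<times> sets \<MM> \<times> UNIV)"
  define Rind where "Rind = (\<lambda>(k, A, b). \<lambda>s. forces_not k A \<zero> s \<or> FF k A b s \<or>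
    (\<exists>x. FF k A x s \<and> forces_not k A (x \<oplus> \<one>) s)) ` ({..<n} \<times> sets \<MM> \<times> UNIV)"
  have "countable (Rdom \<union> Rdec \<union> Rind)"
    unfolding Rdom_def Rdec_def Rind_def
    using assms(1,2) by (intro countable_Un countable_image countable_SIGMA) auto
  moreover obtain s0 where "top_agrees n W s0"
  proof -
    \<comment> \<open>An empty top level agrees with \<open>W\<close> vacuously.\<close>
    obtain c where c: "\<And>i. \<not> fdom c i"
      using finite_function_code[OF dec_bool[of False] dec_bool[of False]] by blast
    obtain s where "lev n s = c" using lev_tuple[of n "\<lambda>_. c"] by auto
    with c that show ?thesis by (auto simp: top_agrees_def)
  qed
  moreover have "\<exists>t. stronger n t s \<and> top_agrees n W t \<and> r t"
    if r: "r \<in> Rdom \<union> Rdec \<union> Rind" and s: "top_agrees n W s" for r s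
  proof -
    have top: "top_agrees n W t" if "lev n t = lev n s" for t using s that by (simp add: top_agrees_def)
    consider j z where "j \<le> n" "r = (\<lambda>s. fdom (lev j s) z)"
      | k A x where "Suc k \<le> n" "A \<in> sets \<MM>" "r = (\<lambda>s. FF k A x s \<or> forces_not k A x s)"
      | k A b where "Suc k \<le> n" "A \<in> sets \<MM>" "r = (\<lambda>s. forces_not k A \<zero> s \<or> FF k A b s \<or>
          (\<exists>x. FF k A x s \<and> forces_not k A (x \<oplus> \<one>) s))"
      using r unfolding Rdom_def Rdec_def Rind_def by (auto simp: Suc_le_eq simp del: FF.simps)
    then show ?thesis
    proof cases
      case 1
      show ?thesis
      proof (cases "j = n")
        case True
        then show ?thesis using dense_top[OF s] 1 by blast
      next
        case False
        then show ?thesis using dense_dom[of j n s z] top 1 by (auto simp del: lev.simps)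
      qed
    next
      case 2
      then show ?thesis using dense_decide[of k n s A x] top by blast
    next
      case 3
      then show ?thesis
        using dense_induct[of A k n s b] models_ISigma_mono[OF ind] top by blast
    qed
  qed
  ultimately obtain q where q: "\<And>i. stronger n (q (Suc i)) (q i)" "\<And>i. top_agrees n W (q i)"
    and meets: "\<And>r. r \<in> Rdom \<union> Rdec \<union> Rind \<Longrightarrow> \<exists>i. r (q i)"
    using generic_sequence[of "Rdom \<union> Rdec \<union> Rind" "top_agrees n W" s0 "stronger n"]
      stronger_refl by blast
  have "generic \<MM> col n W q"
  proof unfold_locales
    show "\<exists>i. fdom (lev j (q i)) z" if "j \<le> n" for j z
      using that by (intro meets[of "\<lambda>s. fdom (lev j s) z"]) (auto simp: Rdom_def)
    show "\<exists>i. FF k A x (q i) \<or> forces_not k A x (q i)" if "Suc k \<le> n" "A \<in> sets \<MM>" for k A x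
      using that by (intro meets[of "\<lambda>s. FF k A x s \<or> forces_not k A x s"]) (force simp: Rdec_def)
    show "\<exists>i. forces_not k A \<zero> (q i) \<or> FF k A b (q i) \<or>
        (\<exists>x. FF k A x (q i) \<and> forces_not k A (x \<oplus> \<one>) (q i))" if "Suc k \<le> n" "A \<in> sets \<MM>" for k A b
      using that by (intro meets[of "\<lambda>s. forces_not k A \<zero> s \<or> FF k A b s \<or>
        (\<exists>x. FF k A x s \<and> forces_not k A (x \<oplus> \<one>) s)"]) (force simp: Rind_def)
  qed (use n q in auto)
  then show ?thesis by (rule that)
qed

text \<open>A Sigma_1 graph of the pairing gives Sigma_1 graphs of both its inverses, which are
  therefore functions of the model. Sigma_1 induction on \<open>d\<close> then bounds the rows of
  all numbers below \<open>d\<close>, so each column eventually leaves every initial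
  segment.\<close>

lemma (in rca_model) pairing_columns:
  assumes "internal_pairing \<MM> p"
  obtains col where "columns \<MM> col" and "\<And>i m. col (p i m) = i"
    and "\<And>i d. \<exists>u. \<forall>m. u \<preceq> m \<longrightarrow> \<not> p i m \<prec> d"
proof -
  have bij: "bij (\<lambda>(i, m). p i m)" using assms by (simp add: internal_pairing_def)
  obtain \<phi> e where \<phi>: "is_Sigma 1 \<phi>"
    and graph: "\<And>i m z. z = p i m \<longleftrightarrow> sat \<MM> (e(0 := i, 1 := m, 2 := z)) (\<lambda>_. {}) \<phi>"
    using assms unfolding internal_pairing_def by blast
  define col where "col z = fst (inv (\<lambda>(i, m). p i m) z)" for z
  define row where "row z = snd (inv (\<lambda>(i, m). p i m) z)" for z
  have inv: "inv (\<lambda>(i, m). p i m) (p i m) = (i, m)" for i m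
    using inv_f_f[OF bij_is_inj[OF bij], of "(i, m)"] by simp
  have col: "col (p i m) = i" and row: "row (p i m) = m" for i m
    by (simp_all add: col_def row_def inv)
  have surj: "\<exists>i m. z = p i m" for z
    using bij_is_surj[OF bij] by (metis case_prod_conv surj_def surj_pair)
  have Sig: "Sig dec 1 (\<lambda>x. h x = p (f x) (g x))" if "cf f" "cf g" "cf h" for f g h
  proof -
    define E where "E = (\<lambda>v. if v = 0 then f else if v = 1 then g else if v = 2 then h else (\<lambda>_. e v))"
    have "cf (E v)" for v using that by (simp add: E_def cf_const)
    \<comment> \<open>\<open>internal_pairing\<close> interprets all set variables by the empty set,
      which belongs to the model.\<close>
    moreover have "dec (\<lambda>x. x \<in> (\<lambda>_::nat. {}) X)" for X by (simp add: dec_False)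
    ultimately have "Sig dec 1 (\<lambda>x. sat \<MM> (\<lambda>v. E v x) (\<lambda>_. {}) \<phi>)"
      using sat_Sig(1)[OF Delta0_closed_dec refl _ \<phi>, of "\<lambda>_. {}" E] by blast
    moreover have "(\<lambda>v. E v x) = e(0 := f x, 1 := g x, 2 := h x)" for x
      by (auto simp: E_def fun_eq_iff)
    ultimately show ?thesis by (simp only: graph)
  qed
  have "pi2 z = col (pi1 z) \<longleftrightarrow> (\<exists>m. pi1 z = p (pi2 z) m)" for z
    using surj[of "pi1 z"] col by metis
  moreover have "Sig dec 1 (\<lambda>z. \<exists>m. pi1 z = p (pi2 z) m)"
    using Sig_ex[OF Delta0_closed_dec Sig[of "\<lambda>w. pi2 (pi1 w)" pi2 "\<lambda>w. pi1 (pi1 w)",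
        unfolded One_nat_def]] by (simp del: Sgm.simps add: cf_pi cf_pi1 cf_pi2)
  ultimately have "cf col" by (intro cf_Sig_graph) (simp del: Sgm.simps)
  have "pi2 z = row (pi1 z) \<longleftrightarrow> (\<exists>i. pi1 z = p i (pi2 z))" for z
    using surj[of "pi1 z"] row by metis
  moreover have "Sig dec 1 (\<lambda>z. \<exists>i. pi1 z = p i (pi2 z))"
    using Sig_ex[OF Delta0_closed_dec Sig[of pi2 "\<lambda>w. pi2 (pi1 w)" "\<lambda>w. pi1 (pi1 w)",
        unfolded One_nat_def]] by (simp del: Sgm.simps add: cf_pi cf_pi1 cf_pi2)
  ultimately have cf_row: "cf row" by (intro cf_Sig_graph) (simp del: Sgm.simps)
  have "\<exists>u. \<forall>z. z \<prec> d \<longrightarrow> row z \<prec> u" for d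
  proof (rule ex_induct[where R = "\<lambda>d u. \<forall>z. z \<prec> d \<longrightarrow> row z \<prec> u"])
    show "dec (\<lambda>z. \<forall>y. y \<prec> pi1 z \<longrightarrow> row y \<prec> pi2 z)"
      by (intro dec_ball dec_less cf_intros cf_comp[OF cf_row])
    fix d u assume u: "\<forall>z. z \<prec> d \<longrightarrow> row z \<prec> u"
    have "u \<preceq> u \<oplus> row d \<oplus> \<one>" unfolding plus_assoc by (rule le_plus)
    moreover have "row d \<prec> u \<oplus> row d \<oplus> \<one>" by (simp only: less_plus_one_iff_le le_plus)
    ultimately have "\<forall>z. z \<prec> d \<oplus> \<one> \<longrightarrow> row z \<prec> u \<oplus> row d \<oplus> \<one>"
      using u M.less_le_trans unfolding less_plus_one[of _ d] by blast
    then show "\<exists>u. \<forall>z. z \<prec> d \<oplus> \<one> \<longrightarrow> row z \<prec> u" ..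
  qed (simp add: not_less_zero)
  then have "\<exists>u. \<forall>m. u \<preceq> m \<longrightarrow> \<not> p i m \<prec> d" for i d
    using row M.leD by metis
  moreover have "columns \<MM> col" by unfold_locales (rule \<open>cf col\<close>)
  ultimately show ?thesis using that col by blast
qed

theorem theorem3p3:
  fixes n :: nat
    and \<MM> :: "'a so_model"
    and p :: "'a \<Rightarrow> 'a \<Rightarrow> 'a"
    and W :: "'a set"
  assumes "n \<ge> 1"
    and "countable_model \<MM>"
    and "models_RCA0 \<MM>"
    and "models_ISigma n \<MM>"
    and "internal_pairing \<MM> p"
  shows "\<exists>\<MM>'. omega_submodel \<MM> \<MM>' \<and>
           models_RCA0 \<MM>' \<and> models_ISigma n \<MM>' \<and>
           (\<exists>S\<in>sets \<MM>'. iter_convergent (numbers \<MM>') p n S \<and>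
                         iter_lim (numbers \<MM>') p n S = W)"
proof -
  interpret rca_model \<MM>
    using assms(2,3) by unfold_locales (auto simp: models_RCA0_def countable_model_def)
  obtain col where "columns \<MM> col" and col: "\<And>i m. col (p i m) = i"
    and rows: "\<And>i d. \<exists>u. \<forall>m. u \<preceq> m \<longrightarrow> \<not> p i m \<prec> d"
    using pairing_columns[OF assms(5)] by blast
  interpret columns \<MM> col by fact
  obtain q where "generic \<MM> col n W q"
    using generic_exists[OF _ _ assms(1,4)] assms(2) unfolding countable_model_def by blast
  then interpret generic \<MM> col n W q .
  have step: "convergent_set (numbers \<MM>) p (G j) \<and> lim_set (numbers \<MM>) p (G j) = G (Suc j)"
    if j: "j < n" for j
  proof -
    have lim: "\<exists>u. \<forall>m. u \<preceq> m \<longrightarrow> (p i m \<in> G j \<longleftrightarrow> i \<in> G (Suc j))" for i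
      by (rule G_limit[OF j col rows])
    have "convergent_set (numbers \<MM>) p (G j)"
      unfolding convergent_set_def using lim M.order_refl by metis
    moreover have "i \<in> lim_set (numbers \<MM>) p (G j) \<longleftrightarrow> i \<in> G (Suc j)" for i
    proof
      assume "i \<in> lim_set (numbers \<MM>) p (G j)"
      then obtain v where v: "\<forall>m. v \<preceq> m \<longrightarrow> p i m \<in> G j" by (auto simp: lim_set_def)
      obtain u where u: "\<forall>m. u \<preceq> m \<longrightarrow> (p i m \<in> G j \<longleftrightarrow> i \<in> G (Suc j))" using lim by blast
      \<comment> \<open>Beyond \<open>u\<close> the column has the value given by
        \<open>G (Suc j)\<close>, beyond \<open>v\<close> it lies in \<open>G j\<close>; the two are
        compared at the common point \<open>u \<oplus> v\<close>.\<close>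
      have "u \<preceq> u \<oplus> v" "v \<preceq> u \<oplus> v" by (rule le_plus)+
      with u v show "i \<in> G (Suc j)" by blast
    qed (use lim[of i] in \<open>auto simp: lim_set_def\<close>)
    ultimately show ?thesis by blast
  qed
  have "iter_convergent (numbers \<MM>) p k (G 0) \<and> iter_lim (numbers \<MM>) p k (G 0) = G k"
    if "k \<le> n" for k
    using that by (induction k) (auto simp: step)
  then have "iter_convergent (numbers \<MM>) p n (G 0) \<and> iter_lim (numbers \<MM>) p n (G 0) = W"
    using G_top by simp
  moreover have "models_ISigma n extension"
    using ISigma_extension[of "n - 1"] assms(1) by simp
  ultimately show ?thesis
    using omega_submodel_extension RCA0_extension G_in_extension
    by (intro exI[of _ extension]) auto
qed

end
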